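(* Let $\Gamma$ be a countable discrete amenable group and let $\mathsf{A}$ be a nonempty finite subset of $\Gamma$. Then $$h_{\mathrm{top}}(X_{\mathsf{A}})=\inf_{F\in\mathscr{F}(\Gamma)}\frac{1}{|F\mathsf{A}^{-1}|}\log|X_{\mathsf{A},F\mathsf{A}^{-1},F}|=\lim_F\frac{1}{|F|}\log|X_{\mathsf{A},F\mathsf{A}^{-1},F}|=\lim_F\frac{1}{|F|}\log|X_{\mathsf{A},F}|,$$ and $$h_{\mathrm{top}}(X_{\mathsf{A}}^{\iota})=\inf_{F\in\mathscr{F}(\Gamma)}\frac{1}{|F|}\log|X_{\mathsf{A},F}^{\iota}|=\lim_F\frac{1}{|F|}\log|X_{\mathsf{A},F}^{\iota}|.$$
   Context: $\mathscr{F}(\Gamma)$ is the collection of all nonempty finite subsets of $\Gamma$. For $F\subseteq\Gamma$ and $x=(x_s)_{s\in F}\in\mathsf{A}^F$ let $\varphi^{(x)}\colon F\to\Gamma$, $\varphi^{(x)}(s)=sx_s$. Put $X_{\mathsf{A}}^{\iota}=\{x\in\mathsf{A}^\Gamma:\varphi^{(x)}\text{ is injective}\}$ and $X_{\mathsf{A}}=\{x\in\mathsf{A}^\Gamma:\varphi^{(x)}\text{ is bijective onto }\Gamma\}$; these are closed subsets of $\mathsf{A}^\Gamma$ (product topology), invariant under the left shift action $(\lambda^sx)_t=x_{s^{-1}t}$. For $F,F'\in\mathscr{F}(\Gamma)$ put $X_{\mathsf{A},F}^{\iota}=\{x\in\mathsf{A}^F:\varphi^{(x)}\text{ is injective}\}$,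 $X_{\mathsf{A},F}=\{x\in X_{\mathsf{A},F}^{\iota}:\varphi^{(x)}(F)\supseteq\{s\in\Gamma:s\mathsf{A}^{-1}\subseteq F\}\}$, $X_{\mathsf{A},F,F'}=\{x\in X_{\mathsf{A},F}^{\iota}:\varphi^{(x)}(F)\supseteq F'\}$. Convention on limits: for a function $\phi\colon\mathscr{F}(\Gamma)\to[-\infty,+\infty)$, $\lim_F\phi(F)=C$ means that for every neighbourhood $U$ of $C$ in $[-\infty,+\infty)$ there are $K\in\mathscr{F}(\Gamma)$ and $\delta>0$ such that $\phi(F)\in U$ for all $F\in\mathscr{F}(\Gamma)$ with $|FK\vartriangle F|<\delta|F|$ (so limits are taken along right F{\o}lner sets). $h_{\mathrm{top}}(X)$ is the topological entropy of the left shift action $\lambda$ of $\Gamma$ on $X$; for a closed left shift-invariant $X\subseteq\mathsf{A}^\Gamma$ it equals $\lim_F\frac1{|F|}\log|\pi_F(X)|$, where $\pi_F$ is restriction of coordinates to $F$. *)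

theory Defs
  imports "HOL-Analysis.Analysis" "HOL-Algebra.Coset"
begin

section \<open>Amenability and limits along right Folner sets\<close>

definition fin_subsets :: "('g, 'm) monoid_scheme \<Rightarrow> 'g set set" where
  "fin_subsets G = {F. F \<subseteq> carrier G \<and> finite F \<and> F \<noteq> {}}"

definition right_invariant_sets ::
  "('g, 'm) monoid_scheme \<Rightarrow> 'g set \<Rightarrow> real \<Rightarrow> 'g set set" where
  "right_invariant_sets G K \<delta> =
     {F \<in> fin_subsets G. real (card (sym_diff (F <#>\<^bsub>G\<^esub> K) F)) < \<delta> * real (card F)}"

definition amenable :: "('g, 'm) monoid_scheme \<Rightarrow> bool" where
  "amenable G \<longleftrightarrow> (\<forall>K \<in> fin_subsets G. \<forall>\<delta>>0. right_invariant_sets G K \<delta> \<noteq> {})"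

text \<open>
  Convergence \<open>(\<phi> \<longlongrightarrow> C) (folner G)\<close> is the convergence of a set function along
  right Folner sets; the lemma \<open>eventually_folner\<close> below spells out the quantifiers.
\<close>

definition folner :: "('g, 'm) monoid_scheme \<Rightarrow> 'g set filter" where
  "folner G = (INF (K, \<delta>) \<in> fin_subsets G \<times> {0<..}. principal (right_invariant_sets G K \<delta>))"

lemma (in group) card_sym_diff_le:
  assumes K: "K \<in> fin_subsets G" and L: "L \<in> fin_subsets G" and KL: "K \<subseteq> L"
    and F: "F \<in> fin_subsets G"
  shows "card (sym_diff (F <#> K) F) \<le> 2 * card (sym_diff (F <#> L) F)"
proof -
  obtain k where k: "k \<in> K" using K by (auto simp: fin_subsets_def)
  have kG: "k \<in> carrier G" using k K by (auto simp: fin_subsets_def)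
  have FG: "F \<subseteq> carrier G" and finF: "finite F" using F by (auto simp: fin_subsets_def)
  have fin: "finite (F <#> L)"
    using finF L by (auto simp: set_mult_def fin_subsets_def)
  define E where "E = (\<lambda>s. s \<otimes> k) ` F"
  have "inj_on (\<lambda>s. s \<otimes> k) F"
    by (rule inj_onI) (use FG kG right_cancel in blast)
  then have cE: "card E = card F" and finE: "finite E"
    unfolding E_def using finF by (auto simp: card_image)
  have "card (F - E) = card (E - F)"
    using card_Diff_subset_Int[of F E] card_Diff_subset_Int[of E F] finE finF cE
    by (simp add: Int_commute)
  moreover have EK: "E \<subseteq> F <#> K" using k by (auto simp: E_def set_mult_def)
  have KLs: "F <#> K \<subseteq> F <#> L" using KL by (auto simp: set_mult_def)
  have "card (F - (F <#> K)) \<le> card (F - E)"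
    by (rule card_mono) (use EK finF in auto)
  moreover have "card (E - F) \<le> card ((F <#> L) - F)"
    by (rule card_mono) (use EK KLs fin in auto)
  moreover have "card ((F <#> K) - F) \<le> card ((F <#> L) - F)"
    by (rule card_mono) (use KLs fin in auto)
  moreover have "card ((F <#> L) - F) \<le> card (sym_diff (F <#> L) F)"
    by (rule card_mono) (use fin finF in auto)
  moreover have "card (sym_diff (F <#> K) F) \<le> card ((F <#> K) - F) + card (F - (F <#> K))"
    by (rule card_Un_le)
  ultimately show ?thesis by linarith
qed

lemma (in group) eventually_folner:
  "eventually P (folner G) \<longleftrightarrow>
     (\<exists>K \<in> fin_subsets G. \<exists>\<delta>>0. \<forall>F \<in> fin_subsets G.
        real (card (sym_diff (F <#> K) F)) < \<delta> * real (card F) \<longrightarrow> P F)"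
proof -
  have ne: "fin_subsets G \<times> {0::real<..} \<noteq> {}"
  proof -
    have "({\<one>}, 1) \<in> fin_subsets G \<times> {0::real<..}" by (auto simp: fin_subsets_def)
    then show ?thesis by blast
  qed
  have dir: "\<exists>x \<in> fin_subsets G \<times> {0::real<..}.
      (case x of (K, \<delta>) \<Rightarrow> principal (right_invariant_sets G K \<delta>))
        \<le> inf (case a of (K, \<delta>) \<Rightarrow> principal (right_invariant_sets G K \<delta>))
              (case b of (K, \<delta>) \<Rightarrow> principal (right_invariant_sets G K \<delta>))"
    if a: "a \<in> fin_subsets G \<times> {0::real<..}" and b: "b \<in> fin_subsets G \<times> {0::real<..}" for a b
  proof -
    obtain K1 d1 K2 d2 where ab: "a = (K1, d1)" "b = (K2, d2)" by (metis surj_pair)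
    let ?L = "K1 \<union> K2" and ?d = "min d1 d2 / 2"
    have K1: "K1 \<in> fin_subsets G" and K2: "K2 \<in> fin_subsets G" and d: "d1 > 0" "d2 > 0"
      using a b ab by auto
    have L: "?L \<in> fin_subsets G" using K1 K2 by (auto simp: fin_subsets_def)
    have "right_invariant_sets G ?L ?d \<subseteq> right_invariant_sets G K d"
      if K: "K \<in> fin_subsets G" "K \<subseteq> ?L" and le: "min d1 d2 \<le> d" for K d
    proof
      fix F assume "F \<in> right_invariant_sets G ?L ?d"
      then have F: "F \<in> fin_subsets G"
        and lt: "real (card (sym_diff (F <#> ?L) F)) < ?d * real (card F)"
        by (simp_all add: right_invariant_sets_def)
      have "real (card (sym_diff (F <#> K) F)) \<le> 2 * real (card (sym_diff (F <#> ?L) F))"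
        using card_sym_diff_le[OF K(1) L K(2) F] by linarith
      also have "\<dots> < min d1 d2 * real (card F)" using lt by simp
      also have "\<dots> \<le> d * real (card F)" using le by (intro mult_right_mono) auto
      finally show "F \<in> right_invariant_sets G K d"
        using F by (simp add: right_invariant_sets_def)
    qed
    then have "right_invariant_sets G ?L ?d
        \<subseteq> right_invariant_sets G K1 d1 \<inter> right_invariant_sets G K2 d2"
      using K1 K2 by simp
    then show ?thesis
      using L d ab by (intro bexI[of _ "(?L, ?d)"]) auto
  qed
  show ?thesis
    unfolding folner_def
    by (subst eventually_INF_base[OF ne dir])
       (auto simp: eventually_principal right_invariant_sets_def Bex_def)
qed

lemma (in group) folner_nontrivial: "amenable G \<longleftrightarrow> folner G \<noteq> bot"
  unfolding trivial_limit_def eventually_folner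
  by (auto simp: amenable_def right_invariant_sets_def)


section \<open>Topological entropy of an action\<close>

definition log_nat :: "nat \<Rightarrow> ereal" where
  "log_nat n = (if n = 0 then -\<infinity> else ereal (ln (real n)))"

definition open_covers :: "'x topology \<Rightarrow> 'x set set set" where
  "open_covers T = {U. (\<forall>V \<in> U. openin T V) \<and> \<Union>U = topspace T}"

definition min_subcover :: "'x topology \<Rightarrow> 'x set set \<Rightarrow> nat" where
  "min_subcover T U = (LEAST n. \<exists>V \<subseteq> U. finite V \<and> card V = n \<and> \<Union>V = topspace T)"

text \<open>
  The join of the covers \<open>s U = {\<alpha> s ` V | V \<in> U}\<close> over \<open>s \<in> F\<close>.  With \<open>F\<close> right Folner,
  \<open>F\<^sup>-\<^sup>1\<close> is left Folner, and this is the usual join of the \<open>s\<^sup>-\<^sup>1 U\<close> over \<open>s \<in> F\<^sup>-\<^sup>1\<close>.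
\<close>

definition cover_join ::
  "'x topology \<Rightarrow> ('g \<Rightarrow> 'x \<Rightarrow> 'x) \<Rightarrow> 'x set set \<Rightarrow> 'g set \<Rightarrow> 'x set set" where
  "cover_join T \<alpha> U F = {topspace T \<inter> (\<Inter>s\<in>F. \<alpha> s ` c s) | c. c \<in> F \<rightarrow> U}"

text \<open>
  Entropy in terms of open covers, for an action \<open>\<alpha>\<close> of \<open>G\<close> by homeomorphisms of a compact
  space \<open>T\<close>.  For amenable \<open>G\<close> the limit along \<open>folner G\<close> exists (Ornstein and Weiss), so the
  upper limit is that limit.
\<close>

definition cover_entropy ::
  "('g, 'm) monoid_scheme \<Rightarrow> 'x topology \<Rightarrow> ('g \<Rightarrow> 'x \<Rightarrow> 'x) \<Rightarrow> 'x set set \<Rightarrow> ereal" where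
  "cover_entropy G T \<alpha> U =
     Limsup (folner G) (\<lambda>F. log_nat (min_subcover T (cover_join T \<alpha> U F)) / ereal (real (card F)))"

definition topological_entropy ::
  "('g, 'm) monoid_scheme \<Rightarrow> 'x topology \<Rightarrow> ('g \<Rightarrow> 'x \<Rightarrow> 'x) \<Rightarrow> ereal" where
  "topological_entropy G T \<alpha> = (SUP U \<in> open_covers T. cover_entropy G T \<alpha> U)"


section \<open>The shift spaces and their finite configurations\<close>

text \<open>Configurations in \<open>A\<^sup>F\<close> are the extensional functions \<open>F \<rightarrow>\<^sub>E A\<close>.\<close>

definition shift :: "('g, 'm) monoid_scheme \<Rightarrow> 'g \<Rightarrow> ('g \<Rightarrow> 'g) \<Rightarrow> 'g \<Rightarrow> 'g" where
  "shift G s x = (\<lambda>t\<in>carrier G. x (inv\<^bsub>G\<^esub> s \<otimes>\<^bsub>G\<^esub> t))"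

definition full_shift_topology ::
  "('g, 'm) monoid_scheme \<Rightarrow> 'g set \<Rightarrow> ('g \<Rightarrow> 'g) topology" where
  "full_shift_topology G A = product_topology (\<lambda>_. discrete_topology A) (carrier G)"

definition shift_entropy ::
  "('g, 'm) monoid_scheme \<Rightarrow> 'g set \<Rightarrow> ('g \<Rightarrow> 'g) set \<Rightarrow> ereal" where
  "shift_entropy G A X =
     topological_entropy G (subtopology (full_shift_topology G A) X) (shift G)"

definition mult_map :: "('g, 'm) monoid_scheme \<Rightarrow> ('g \<Rightarrow> 'g) \<Rightarrow> 'g \<Rightarrow> 'g" where
  "mult_map G x s = s \<otimes>\<^bsub>G\<^esub> x s"

definition X_inj :: "('g, 'm) monoid_scheme \<Rightarrow> 'g set \<Rightarrow> ('g \<Rightarrow> 'g) set" where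
  "X_inj G A = {x \<in> carrier G \<rightarrow>\<^sub>E A. inj_on (mult_map G x) (carrier G)}"

definition X_bij :: "('g, 'm) monoid_scheme \<Rightarrow> 'g set \<Rightarrow> ('g \<Rightarrow> 'g) set" where
  "X_bij G A = {x \<in> carrier G \<rightarrow>\<^sub>E A. bij_betw (mult_map G x) (carrier G) (carrier G)}"

definition X_inj_on :: "('g, 'm) monoid_scheme \<Rightarrow> 'g set \<Rightarrow> 'g set \<Rightarrow> ('g \<Rightarrow> 'g) set" where
  "X_inj_on G A F = {x \<in> F \<rightarrow>\<^sub>E A. inj_on (mult_map G x) F}"

definition X_bij_on :: "('g, 'm) monoid_scheme \<Rightarrow> 'g set \<Rightarrow> 'g set \<Rightarrow> ('g \<Rightarrow> 'g) set" where
  "X_bij_on G A F =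
     {x \<in> X_inj_on G A F.
        {s \<in> carrier G. s <#\<^bsub>G\<^esub> (set_inv\<^bsub>G\<^esub> A) \<subseteq> F} \<subseteq> mult_map G x ` F}"

definition X_onto ::
  "('g, 'm) monoid_scheme \<Rightarrow> 'g set \<Rightarrow> 'g set \<Rightarrow> 'g set \<Rightarrow> ('g \<Rightarrow> 'g) set" where
  "X_onto G A F F' = {x \<in> X_inj_on G A F. F' \<subseteq> mult_map G x ` F}"

end

theory Submission
  imports Defs
begin

text \<open>
  For a closed shift-invariant \<open>X\<close> let \<open>h = inf\<^sub>F log |\<pi>\<^sub>F(X)| / |F|\<close>.  If every configuration in \<open>S(F)\<close>
  looks like one of \<open>X\<close> on each translate of a fixed window \<open>F\<^sub>0\<close> that lies deep inside \<open>F\<close>, then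
  Shearer's inequality for the cover of \<open>F\<close> by the translates of \<open>F\<^sub>0\<close>, each point being covered
  \<open>|F\<^sub>0|\<close> times, bounds the upper limit of \<open>log |S(F)| / |F|\<close> by the value at \<open>F\<^sub>0\<close> of the quotient
  defining \<open>h\<close>, hence by \<open>h\<close>.  By compactness the finite configurations satisfying the local rules of
  \<open>X\<close> are of this kind, and since they contain all restrictions of \<open>X\<close> the limits equal \<open>h\<close>.  The
  same bound for \<open>S(F) = \<pi>\<^sub>F\<^sub>K(X)\<close> with a Lebesgue number argument identifies \<open>h\<close> with the entropy.
\<close>

section \<open>Shearer's inequality\<close>

text \<open>Shearer's inequality tolerates overlapping translates, which spares a quasi-tiling of
  the Folner set. The obstacle is that a configuration counted over \<open>F\<close> need not be the
  restriction of a point of \<open>X\<close>: it may have no extension obeying the rules, and close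
  to the boundary of \<open>F\<close> it can escape the surjectivity rule. So agreement with
  \<open>X\<close> is asked for only on windows deep inside, and each window may use its own point
  of \<open>X\<close>. The inverse letters in the windows come from solving
  \<open>s \<otimes> x s = h\<close>: the solution is \<open>s = h \<otimes> inv a\<close> for some
  letter \<open>a\<close>, so whether \<open>h\<close> is hit is decided on the finite set
  \<open>h <# set_inv A\<close>. The infimum of the quotients by the size of
  \<open>F <#> set_inv A\<close> is caught between two equal numbers. It is at least h because
  restrictions of \<open>X\<close> are among the configurations counted, and at most the limit of
  the quotients by \<open>card F\<close> because \<open>F <#> set_inv A\<close> has at least as many
  elements as \<open>F\<close>.\<close>

definition agree :: "('i \<Rightarrow> 'a) set \<Rightarrow> 'i set \<Rightarrow> ('i \<Rightarrow> 'a) \<Rightarrow> ('i \<Rightarrow> 'a) set" where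
  "agree S F x = {y \<in> S. \<forall>i\<in>F. y i = x i}"

text \<open>Shannon entropy, in nats, of the restriction to \<open>F\<close> of a uniformly random
  element of a finite nonempty \<open>S\<close>: the fibre of \<open>x\<close> has probability
  \<open>card (agree S F x) / card S\<close>, and the average of minus its logarithm is this
  expression.\<close>

definition coord_entropy :: "('i \<Rightarrow> 'a) set \<Rightarrow> 'i set \<Rightarrow> real" where
  "coord_entropy S F = ln (card S) - (\<Sum>x\<in>S. ln (card (agree S F x))) / card S"

lemma agree_eq: "y \<in> agree S F x \<Longrightarrow> agree S F y = agree S F x"
  by (auto simp: agree_def)

lemma finite_agree [simp]: "finite S \<Longrightarrow> finite (agree S F x)"
  by (simp add: agree_def)

lemma card_agree_pos: "finite S \<Longrightarrow> x \<in> S \<Longrightarrow> 0 < card (agree S F x)"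
  by (auto simp: card_gt_0_iff agree_def)

lemma sum_inverse_card_agree:
  assumes "finite S" "x \<in> S"
  shows "(\<Sum>y\<in>agree S F x. 1 / real (card (agree S F y))) = 1"
proof -
  have "(\<Sum>y\<in>agree S F x. 1 / real (card (agree S F y)))
      = (\<Sum>y\<in>agree S F x. 1 / real (card (agree S F x)))"
    by (intro sum.cong) (auto dest: agree_eq)
  then show ?thesis
    using card_agree_pos[OF assms] by simp
qed

text \<open>The weights in each fibre of the restriction to \<open>F\<close> add up to 1, so the sum
  counts fibres.\<close>

lemma sum_inverse_card_agree_total:
  assumes "finite S"
  shows "(\<Sum>x\<in>S. 1 / real (card (agree S F x))) = card ((\<lambda>x. restrict x F) ` S)"
proof -
  have "(\<Sum>x\<in>S. 1 / real (card (agree S F x)))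
      = (\<Sum>p\<in>(\<lambda>x. restrict x F) ` S. \<Sum>x | x \<in> S \<and> restrict x F = p. 1 / real (card (agree S F x)))"
    using assms by (rule sum.image_gen)
  also have "\<dots> = (\<Sum>p\<in>(\<lambda>x. restrict x F) ` S. 1)"
  proof (rule sum.cong[OF refl])
    fix p assume "p \<in> (\<lambda>x. restrict x F) ` S"
    then obtain x where x: "x \<in> S" "p = restrict x F" by auto
    have eq: "restrict y F = restrict x F \<longleftrightarrow> (\<forall>i\<in>F. y i = x i)" for y
      by (auto simp: fun_eq_iff restrict_def split: if_splits)
    have "{y. y \<in> S \<and> restrict y F = p} = agree S F x"
      by (auto simp: agree_def x eq)
    then show "(\<Sum>x | x \<in> S \<and> restrict x F = p. 1 / real (card (agree S F x))) = 1"
      using sum_inverse_card_agree[OF assms x(1), of F] by simp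
  qed
  finally show ?thesis by simp
qed

text \<open>The uniform distribution has maximal entropy. The bound \<open>ln t <= t - 1\<close> is
  applied to the quotient \<open>t\<close> of the uniform probability \<open>1 / M\<close> of a
  pattern by its actual probability; these quotients average to 1 over \<open>S\<close>.\<close>

lemma coord_entropy_le:
  assumes S: "finite S" "S \<noteq> {}"
  shows "coord_entropy S F \<le> ln (card ((\<lambda>x. restrict x F) ` S))"
proof -
  define N M where "N = real (card S)" and "M = real (card ((\<lambda>x. restrict x F) ` S))"
  have N: "N > 0" and M: "M > 0" using S by (auto simp: N_def M_def card_gt_0_iff)
  have "(\<Sum>x\<in>S. ln N - ln M - ln (card (agree S F x))) \<le> (\<Sum>x\<in>S. N / M * (1 / card (agree S F x)) - 1)"
  proof (rule sum_mono)
    fix x assume "x \<in> S"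
    then have c: "real (card (agree S F x)) > 0" using card_agree_pos[OF S(1)] by simp
    have "ln N - ln M - ln (card (agree S F x)) = ln (N / M * (1 / card (agree S F x)))"
      using N M c by (simp add: ln_div ln_mult)
    also have "\<dots> \<le> N / M * (1 / card (agree S F x)) - 1"
      using N M c by (intro ln_le_minus_one) simp
    finally show "ln N - ln M - ln (card (agree S F x)) \<le> N / M * (1 / card (agree S F x)) - 1" .
  qed
  also have "\<dots> = N / M * (\<Sum>x\<in>S. 1 / card (agree S F x)) - N"
    by (simp add: sum_subtractf sum_distrib_left N_def)
  also have "\<dots> = 0"
    using M by (simp add: sum_inverse_card_agree_total[OF S(1)] M_def)
  finally have "N * (ln N - ln M) \<le> (\<Sum>x\<in>S. ln (card (agree S F x)))"
    by (simp add: sum_subtractf N_def right_diff_distrib)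
  then have "ln N - ln M \<le> (\<Sum>x\<in>S. ln (card (agree S F x))) / N"
    using N by (simp add: field_simps)
  then show ?thesis by (simp add: coord_entropy_def N_def M_def)
qed

text \<open>Equivalent to the averages of \<open>ln (?q x)\<close> being at most 0, which follows
  from \<open>ln t <= t - 1\<close> once \<open>?q\<close> has average at most 1. For that the
  product of the fibre sizes over \<open>F1\<close> and \<open>F2\<close> is expanded into pairs
  \<open>y\<close>, \<open>z\<close> agreeing with \<open>x\<close> on \<open>F1\<close> and on
  \<open>F2\<close>, and the sum over \<open>x\<close> is moved inside. The fibres of
  \<open>x\<close> and \<open>z\<close> over \<open>F1 \<inter> F2\<close> coincide, so that weight
  can be read off at \<open>z\<close>.\<close>

lemma coord_entropy_submodular:
  assumes S: "finite S" "S \<noteq> {}"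
  shows "coord_entropy S (F1 \<union> F2) + coord_entropy S (F1 \<inter> F2)
    \<le> coord_entropy S F1 + coord_entropy S F2"
proof -
  let ?c = "\<lambda>F x. real (card (agree S F x))"
  let ?q = "\<lambda>x. ?c F1 x * ?c F2 x / (?c (F1 \<union> F2) x * ?c (F1 \<inter> F2) x)"
  have c: "?c F x > 0" if "x \<in> S" for F x
    using card_agree_pos[OF S(1) that] by simp
  have ext: "?c F x = (\<Sum>y\<in>S. if y \<in> agree S F x then 1 else 0)" for F x
    by (simp add: sum.If_cases[OF S(1)]) (auto simp: agree_def intro: arg_cong[where f=card])
  have "(\<Sum>x\<in>S. ?q x)
    = (\<Sum>x\<in>S. \<Sum>z\<in>S. \<Sum>y\<in>S. if z \<in> agree S F2 x \<and> y \<in> agree S F1 x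
        then 1 / ?c (F1 \<union> F2) x / ?c (F1 \<inter> F2) z else 0)"
  proof (rule sum.cong[OF refl])
    fix x assume x: "x \<in> S"
    have "(\<Sum>z\<in>S. \<Sum>y\<in>S. if z \<in> agree S F2 x \<and> y \<in> agree S F1 x
        then 1 / ?c (F1 \<union> F2) x / ?c (F1 \<inter> F2) z else 0)
      = (\<Sum>z\<in>S. \<Sum>y\<in>S. (if z \<in> agree S F2 x then 1 else 0) * (if y \<in> agree S F1 x then 1 else 0)
          * (1 / ?c (F1 \<union> F2) x / ?c (F1 \<inter> F2) x))"
    proof (intro sum.cong refl)
      fix z y
      have "agree S (F1 \<inter> F2) z = agree S (F1 \<inter> F2) x" if "z \<in> agree S F2 x"
        using that by (auto simp: agree_def)
      then show "(if z \<in> agree S F2 x \<and> y \<in> agree S F1 x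
          then 1 / ?c (F1 \<union> F2) x / ?c (F1 \<inter> F2) z else 0)
        = (if z \<in> agree S F2 x then 1 else 0) * (if y \<in> agree S F1 x then 1 else 0)
          * (1 / ?c (F1 \<union> F2) x / ?c (F1 \<inter> F2) x)" by simp
    qed
    also have "\<dots> = (\<Sum>z\<in>S. (if z \<in> agree S F2 x then 1 else 0)) * (\<Sum>y\<in>S. (if y \<in> agree S F1 x then 1 else 0))
          * (1 / ?c (F1 \<union> F2) x / ?c (F1 \<inter> F2) x)"
      by (subst sum_product) (simp only: sum_distrib_right)
    also have "\<dots> = ?q x" unfolding ext[symmetric] by (simp add: mult.commute)
    finally show "?q x = (\<Sum>z\<in>S. \<Sum>y\<in>S. if z \<in> agree S F2 x \<and> y \<in> agree S F1 x
        then 1 / ?c (F1 \<union> F2) x / ?c (F1 \<inter> F2) z else 0)" ..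
  qed
  also have "\<dots> = (\<Sum>z\<in>S. \<Sum>y\<in>S. \<Sum>x\<in>S. if z \<in> agree S F2 x \<and> y \<in> agree S F1 x
        then 1 / ?c (F1 \<union> F2) x / ?c (F1 \<inter> F2) z else 0)"
    by (subst sum.swap, intro sum.cong[OF refl] sum.swap)
  also have "\<dots> \<le> (\<Sum>z\<in>S. \<Sum>y\<in>S. if y \<in> agree S (F1 \<inter> F2) z then 1 / ?c (F1 \<inter> F2) z else 0)"
  proof (intro sum_mono)
    fix z y assume z: "z \<in> S" and y: "y \<in> S"
    \<comment> \<open>For fixed \<open>y\<close> and \<open>z\<close> the values of \<open>x\<close>
      on \<open>F1 \<union> F2\<close> are prescribed, so the admissible \<open>x\<close> form one
      fibre or none, of total weight at most 1; if there is one, \<open>y\<close> and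
      \<open>z\<close> agree on \<open>F1 \<inter> F2\<close>.\<close>
    let ?B = "{x \<in> S. z \<in> agree S F2 x \<and> y \<in> agree S F1 x}"
    have sumB: "(\<Sum>x\<in>S. if z \<in> agree S F2 x \<and> y \<in> agree S F1 x
        then 1 / ?c (F1 \<union> F2) x / ?c (F1 \<inter> F2) z else 0)
      = (\<Sum>x\<in>?B. 1 / ?c (F1 \<union> F2) x) / ?c (F1 \<inter> F2) z"
      by (simp add: sum.inter_filter[OF S(1), symmetric] sum_divide_distrib)
    show "(\<Sum>x\<in>S. if z \<in> agree S F2 x \<and> y \<in> agree S F1 x
        then 1 / ?c (F1 \<union> F2) x / ?c (F1 \<inter> F2) z else 0)
      \<le> (if y \<in> agree S (F1 \<inter> F2) z then 1 / ?c (F1 \<inter> F2) z else 0)"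
    proof (cases "?B = {}")
      case True
      then show ?thesis unfolding sumB True by simp
    next
      case False
      then obtain x where x: "x \<in> ?B" by blast
      then have xS: "x \<in> S" by blast
      have "?B = agree S (F1 \<union> F2) x"
        using x by (auto simp: agree_def)
      moreover have "y \<in> agree S (F1 \<inter> F2) z"
        using x y by (auto simp: agree_def)
      ultimately show ?thesis
        unfolding sumB using sum_inverse_card_agree[OF S(1) xS, of "F1 \<union> F2"] by simp
    qed
  qed
  also have "\<dots> = (\<Sum>z\<in>S. 1)"
  proof (rule sum.cong[OF refl])
    fix z assume z: "z \<in> S"
    have "(\<Sum>y\<in>S. if y \<in> agree S (F1 \<inter> F2) z then 1 / ?c (F1 \<inter> F2) z else 0)
      = (\<Sum>y\<in>S. if y \<in> agree S (F1 \<inter> F2) z then 1 else 0) / ?c (F1 \<inter> F2) z"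
      unfolding sum_divide_distrib by (intro sum.cong) auto
    then show "(\<Sum>y\<in>S. if y \<in> agree S (F1 \<inter> F2) z then 1 / ?c (F1 \<inter> F2) z else 0) = 1"
      unfolding ext[symmetric] using c[OF z, of "F1 \<inter> F2"] by simp
  qed
  finally have q: "(\<Sum>x\<in>S. ?q x) \<le> real (card S)" by simp
  have "(\<Sum>x\<in>S. ln (?c F1 x) + ln (?c F2 x) - ln (?c (F1 \<union> F2) x) - ln (?c (F1 \<inter> F2) x))
      \<le> (\<Sum>x\<in>S. ?q x - 1)"
  proof (rule sum_mono)
    fix x assume x: "x \<in> S"
    have "ln (?c F1 x) + ln (?c F2 x) - ln (?c (F1 \<union> F2) x) - ln (?c (F1 \<inter> F2) x) = ln (?q x)"
      using c[OF x] by (simp add: ln_div ln_mult)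
    also have "\<dots> \<le> ?q x - 1"
      using c[OF x] by (intro ln_le_minus_one) simp
    finally show "ln (?c F1 x) + ln (?c F2 x) - ln (?c (F1 \<union> F2) x) - ln (?c (F1 \<inter> F2) x) \<le> ?q x - 1" .
  qed
  also have "\<dots> \<le> 0" using q by (simp add: sum_subtractf)
  finally have "((\<Sum>x\<in>S. ln (?c F1 x)) + (\<Sum>x\<in>S. ln (?c F2 x))) / card S
      \<le> ((\<Sum>x\<in>S. ln (?c (F1 \<union> F2) x)) + (\<Sum>x\<in>S. ln (?c (F1 \<inter> F2) x))) / card S"
    by (intro divide_right_mono) (auto simp: sum_subtractf sum.distrib)
  then show ?thesis
    by (simp add: coord_entropy_def add_divide_distrib)
qed

text \<open>Induction adding one point \<open>i\<close> at a time: by submodularity its gain over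
  \<open>D\<close> is at most its gain over the smaller set \<open>F j \<inter> D\<close>, and
  exactly \<open>k\<close> indices \<open>j\<close> see the point.\<close>

lemma Shearer_coord_entropy:
  assumes S: "finite S" "S \<noteq> {}" and J: "finite J" and D: "finite D"
    and cover: "\<And>i. i \<in> D \<Longrightarrow> card {j \<in> J. i \<in> F j} = k"
  shows "real k * coord_entropy S D \<le> (\<Sum>j\<in>J. coord_entropy S (F j \<inter> D))"
  using D cover
proof (induction D rule: finite_induct)
  case empty
  show ?case by (simp add: coord_entropy_def agree_def)
next
  case (insert i D)
  let ?H = "coord_entropy S"
  have IH: "k * ?H D \<le> (\<Sum>j\<in>J. ?H (F j \<inter> D))" using insert by auto
  have "k * (?H (insert i D) - ?H D) = (\<Sum>j | j \<in> J \<and> i \<in> F j. ?H (insert i D) - ?H D)"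
    using insert.prems[of i] by simp
  also have "\<dots> = (\<Sum>j\<in>J. if i \<in> F j then ?H (insert i D) - ?H D else 0)"
    by (rule sum.inter_filter[OF J])
  also have "\<dots> \<le> (\<Sum>j\<in>J. ?H (F j \<inter> insert i D) - ?H (F j \<inter> D))"
  proof (rule sum_mono)
    fix j
    show "(if i \<in> F j then ?H (insert i D) - ?H D else 0) \<le> ?H (F j \<inter> insert i D) - ?H (F j \<inter> D)"
    proof (cases "i \<in> F j")
      case True
      have "(F j \<inter> insert i D) \<union> D = insert i D" "(F j \<inter> insert i D) \<inter> D = F j \<inter> D"
        using True insert.hyps by auto
      then show ?thesis
        using coord_entropy_submodular[OF S, of "F j \<inter> insert i D" D] True by simp
    qed simp
  qed
  finally show ?case using IH by (simp add: sum_subtractf algebra_simps)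
qed

text \<open>Extensional functions on \<open>D\<close> are determined by their values there, so the
  fibres over \<open>D\<close> are single points and the entropy of \<open>D\<close> is the full
  \<open>ln (card S)\<close>.\<close>

lemma Shearer:
  assumes S: "finite S" "S \<noteq> {}" "S \<subseteq> extensional D" and J: "finite J" and D: "finite D"
    and cover: "\<And>i. i \<in> D \<Longrightarrow> card {j \<in> J. i \<in> F j} = k"
  shows "real k * ln (card S) \<le> (\<Sum>j\<in>J. ln (card ((\<lambda>x. restrict x (F j \<inter> D)) ` S)))"
proof -
  have "agree S D x = {x}" if "x \<in> S" for x
    using that S(3) by (auto simp: agree_def intro!: extensionalityI[of _ D])
  then have "(\<Sum>x\<in>S. ln (real (card (agree S D x)))) = 0"
    by (intro sum.neutral) simp
  then have "ln (card S) = coord_entropy S D"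
    by (simp add: coord_entropy_def)
  then have "real k * ln (card S) \<le> (\<Sum>j\<in>J. coord_entropy S (F j \<inter> D))"
    using Shearer_coord_entropy[OF S(1,2) J D cover] by simp
  also have "\<dots> \<le> (\<Sum>j\<in>J. ln (card ((\<lambda>x. restrict x (F j \<inter> D)) ` S)))"
    by (intro sum_mono coord_entropy_le S)
  finally show ?thesis .
qed

section \<open>Counting along Folner sets\<close>

context group begin

lemma fin_subsetsD:
  assumes "F \<in> fin_subsets G"
  shows "F \<subseteq> carrier G" "finite F" "F \<noteq> {}" "0 < card F"
  using assms by (auto simp: fin_subsets_def card_gt_0_iff)

lemma fin_subsets_Un: "F \<in> fin_subsets G \<Longrightarrow> K \<in> fin_subsets G \<Longrightarrow> F \<union> K \<in> fin_subsets G"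
  by (auto simp: fin_subsets_def)

lemma fin_subsets_set_mult:
  "F \<in> fin_subsets G \<Longrightarrow> K \<in> fin_subsets G \<Longrightarrow> F <#> K \<in> fin_subsets G"
  by (auto simp: fin_subsets_def set_mult_def)

lemma fin_subsets_set_inv: "F \<in> fin_subsets G \<Longrightarrow> set_inv F \<in> fin_subsets G"
  by (auto simp: fin_subsets_def SET_INV_def)

lemma fin_subsets_l_coset:
  "g \<in> carrier G \<Longrightarrow> F \<in> fin_subsets G \<Longrightarrow> g <# F \<in> fin_subsets G"
  by (auto simp: fin_subsets_def l_coset_def)

lemma fin_subsets_singleton: "g \<in> carrier G \<Longrightarrow> {g} \<in> fin_subsets G"
  by (auto simp: fin_subsets_def)

text \<open>A point \<open>g\<close> of the boundary has some \<open>g \<otimes> l\<close> outside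
  \<open>F\<close>, hence in \<open>F <#> K\<close> without \<open>F\<close>. Right multiplication
  by \<open>l\<close> is injective, and \<open>card L\<close> comes from the union over
  \<open>l\<close>.\<close>

lemma card_right_boundary_le:
  assumes F: "F \<in> fin_subsets G" and L: "L \<in> fin_subsets G" and K: "K \<in> fin_subsets G" and LK: "L \<subseteq> K"
  shows "card {g \<in> F. \<not> g <# L \<subseteq> F} \<le> card L * card (sym_diff (F <#> K) F)"
proof -
  have fin: "finite (sym_diff (F <#> K) F)"
    using fin_subsetsD[OF fin_subsets_set_mult[OF F K]] fin_subsetsD[OF F] by auto
  have "{g \<in> F. \<not> g <# L \<subseteq> F} \<subseteq> (\<Union>l\<in>L. {g \<in> F. g \<otimes> l \<notin> F})"
    by (auto simp: l_coset_def)
  then have "card {g \<in> F. \<not> g <# L \<subseteq> F} \<le> card (\<Union>l\<in>L. {g \<in> F. g \<otimes> l \<notin> F})"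
    using fin_subsetsD(2)[OF F] fin_subsetsD(2)[OF L] by (intro card_mono) auto
  also have "\<dots> \<le> (\<Sum>l\<in>L. card {g \<in> F. g \<otimes> l \<notin> F})"
    using fin_subsetsD(2)[OF L] by (rule card_UN_le)
  also have "\<dots> \<le> (\<Sum>l\<in>L. card (sym_diff (F <#> K) F))"
  proof (rule sum_mono)
    fix l assume l: "l \<in> L"
    then have lG: "l \<in> carrier G" using fin_subsetsD(1)[OF L] by auto
    have "inj_on (\<lambda>g. g \<otimes> l) {g \<in> F. g \<otimes> l \<notin> F}"
      by (rule inj_onI) (use fin_subsetsD(1)[OF F] lG right_cancel in blast)
    moreover have "(\<lambda>g. g \<otimes> l) ` {g \<in> F. g \<otimes> l \<notin> F} \<subseteq> sym_diff (F <#> K) F"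
      using l LK by (auto simp: set_mult_def)
    ultimately show "card {g \<in> F. g \<otimes> l \<notin> F} \<le> card (sym_diff (F <#> K) F)"
      using fin by (rule card_inj_on_le)
  qed
  finally show ?thesis by simp
qed

text \<open>Solving \<open>t = g \<otimes> f\<close> gives \<open>g = t \<otimes> inv f\<close>, one
  translate for each \<open>f\<close>, all of them in the index set. This is the multiplicity
  \<open>k\<close> for Shearer's inequality.\<close>

lemma card_translates_containing:
  assumes D: "D \<subseteq> carrier G" and F: "F \<in> fin_subsets G" and t: "t \<in> D"
  shows "card {g \<in> D <#> set_inv F. t \<in> g <# F} = card F"
proof -
  have tG: "t \<in> carrier G" and FG: "F \<subseteq> carrier G" using assms fin_subsetsD by auto
  have "{g \<in> D <#> set_inv F. t \<in> g <# F} = (\<lambda>f. t \<otimes> inv f) ` F"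
  proof safe
    fix g assume g: "g \<in> D <#> set_inv F" "t \<in> g <# F"
    then obtain f where f: "f \<in> F" "t = g \<otimes> f" by (auto simp: l_coset_def)
    moreover have "g \<in> carrier G" using g D FG by (auto simp: set_mult_def SET_INV_def)
    ultimately have "g = t \<otimes> inv f" using FG by (simp add: inv_solve_right subset_iff)
    then show "g \<in> (\<lambda>f. t \<otimes> inv f) ` F" using f by auto
  next
    fix f assume "f \<in> F"
    then show "t \<otimes> inv f \<in> D <#> set_inv F" using t by (auto simp: set_mult_def SET_INV_def)
  next
    fix f assume f: "f \<in> F"
    then have "t = (t \<otimes> inv f) \<otimes> f" using tG FG by (simp add: m_assoc subset_iff)
    then show "t \<in> (t \<otimes> inv f) <# F" using f unfolding l_coset_def by blast
  qed
  moreover have "inj_on (\<lambda>f. t \<otimes> inv f) F"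
    by (rule inj_onI) (use tG FG in \<open>metis inv_closed inv_inv Units_l_cancel Units_eq subsetD\<close>)
  ultimately show ?thesis by (simp add: card_image)
qed

end

definition patterns :: "('i \<Rightarrow> 'a) set \<Rightarrow> 'i set \<Rightarrow> ('i \<Rightarrow> 'a) set" where
  "patterns X F = (\<lambda>x. restrict x F) ` X"

definition shift_invariant :: "('g, 'm) monoid_scheme \<Rightarrow> ('g \<Rightarrow> 'g) set \<Rightarrow> bool" where
  "shift_invariant G X \<longleftrightarrow> (\<forall>s \<in> carrier G. \<forall>x \<in> X. shift G s x \<in> X)"

lemma patterns_subset: "X \<subseteq> D \<rightarrow>\<^sub>E A \<Longrightarrow> F \<subseteq> D \<Longrightarrow> patterns X F \<subseteq> F \<rightarrow>\<^sub>E A"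
  by (fastforce simp: patterns_def)

locale amenable_alphabet = group +
  fixes A :: "'a set"
  assumes amenable: "amenable G" and finite_A: "finite A" and A_ne: "A \<noteq> {}"
    and A_carrier: "A \<subseteq> carrier G"
begin

lemma A_fin_subsets: "A \<in> fin_subsets G"
  using finite_A A_ne A_carrier by (simp add: fin_subsets_def)

lemma card_A_pos: "card A > 0"
  using finite_A A_ne by (simp add: card_gt_0_iff)

lemma finite_configs:
  assumes "F \<in> fin_subsets G" "S \<subseteq> F \<rightarrow>\<^sub>E A"
  shows "finite S"
  using finite_PiE[of F "\<lambda>_. A"] fin_subsetsD(2)[OF assms(1)] finite_A assms(2) finite_subset by blast

lemma finite_patterns:
  assumes "X \<subseteq> carrier G \<rightarrow>\<^sub>E A" "F \<in> fin_subsets G"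
  shows "finite (patterns X F)"
  using finite_configs[OF assms(2) patterns_subset[OF assms(1)]] fin_subsetsD[OF assms(2)] by blast

lemma shift_apply: "t \<in> carrier G \<Longrightarrow> shift G s x t = x (inv s \<otimes> t)"
  by (simp add: shift_def)

lemma shift_closed: "s \<in> carrier G \<Longrightarrow> x \<in> carrier G \<rightarrow>\<^sub>E A \<Longrightarrow> shift G s x \<in> carrier G \<rightarrow>\<^sub>E A"
  by (auto simp: shift_def)

lemma shift_shift_inv:
  assumes s: "s \<in> carrier G" and x: "x \<in> carrier G \<rightarrow>\<^sub>E A"
  shows "shift G s (shift G (inv s) x) = x"
proof (rule extensionalityI[of _ "carrier G"])
  show "shift G s (shift G (inv s) x) \<in> extensional (carrier G)" by (simp add: shift_def)
  show "x \<in> extensional (carrier G)" using x by (simp add: PiE_def)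
  fix t assume t: "t \<in> carrier G"
  then show "shift G s (shift G (inv s) x) t = x t"
    using s by (simp add: shift_def m_assoc[symmetric])
qed

text \<open>Shifting by \<open>inv g\<close> carries the window \<open>g <# F\<close> back to
  \<open>F\<close> and stays in \<open>X\<close>.\<close>

lemma card_patterns_l_coset_le:
  assumes X: "X \<subseteq> carrier G \<rightarrow>\<^sub>E A" "shift_invariant G X" and F: "F \<in> fin_subsets G" and g: "g \<in> carrier G"
  shows "card (patterns X (g <# F)) \<le> card (patterns X F)"
proof -
  have FG: "F \<subseteq> carrier G" using F fin_subsetsD by auto
  have "patterns X (g <# F) \<subseteq> (\<lambda>p. \<lambda>t\<in>g <# F. p (inv g \<otimes> t)) ` patterns X F"
  proof
    fix p assume "p \<in> patterns X (g <# F)"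
    then obtain x where x: "x \<in> X" "p = restrict x (g <# F)" by (auto simp: patterns_def)
    let ?y = "shift G (inv g) x"
    have "?y \<in> X" using X(2) x g by (auto simp: shift_invariant_def)
    moreover have "restrict ?y F (inv g \<otimes> t) = x t" if t: "t \<in> g <# F" for t
    proof -
      obtain f where f: "f \<in> F" "t = g \<otimes> f" using t by (auto simp: l_coset_def)
      then have "inv g \<otimes> t = f" using FG g by (auto simp: m_assoc[symmetric])
      then show ?thesis using f FG g by (auto simp: shift_apply)
    qed
    then have "p = (\<lambda>t\<in>g <# F. restrict ?y F (inv g \<otimes> t))"
      unfolding x(2) by (auto simp: restrict_def fun_eq_iff)
    ultimately show "p \<in> (\<lambda>p. \<lambda>t\<in>g <# F. p (inv g \<otimes> t)) ` patterns X F"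
      unfolding patterns_def by blast
  qed
  then show ?thesis
    using surj_card_le finite_patterns[OF X(1) F] by blast
qed

text \<open>Shearer's inequality is applied to the translates of \<open>F0\<close>; only those that are not
  deep inside the Folner set fail to be governed by \<open>X\<close>.\<close>

lemma eventually_rate_le:
  assumes X: "X \<subseteq> carrier G \<rightarrow>\<^sub>E A" "shift_invariant G X" "X \<noteq> {}"
    and F0: "F0 \<in> fin_subsets G" and K: "K \<in> fin_subsets G" and L: "L \<in> fin_subsets G"
    and S: "\<And>F. F \<in> fin_subsets G \<Longrightarrow> S F \<subseteq> D F \<rightarrow>\<^sub>E A" "\<And>F. F \<in> fin_subsets G \<Longrightarrow> S F \<noteq> {}"
    and D: "\<And>F. F \<in> fin_subsets G \<Longrightarrow> D F \<subseteq> F <#> K"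
    and loc: "\<And>F g x. F \<in> fin_subsets G \<Longrightarrow> g \<in> carrier G \<Longrightarrow> g <# L \<subseteq> F \<Longrightarrow> x \<in> S F \<Longrightarrow>
      \<exists>z\<in>X. \<forall>t\<in>(g <# F0) \<inter> D F. x t = z t"
    and \<epsilon>: "\<epsilon> > 0"
  shows "\<forall>\<^sub>F F in folner G. F \<in> fin_subsets G \<and>
    ln (card (S F)) / card F \<le> ln (card (patterns X F0)) / card F0 + \<epsilon>"
proof -
  define L' where "L' = insert \<one> L"
  \<comment> \<open>Invariance under \<open>M\<close> controls both kinds of bad translates: the
    first part puts every index \<open>g\<close> into \<open>F <#> M\<close>, the second bounds the
    number of \<open>g\<close> in \<open>F\<close> that are too close to the boundary.\<close>
  define M where "M = (K <#> set_inv F0) \<union> L'"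
  have L': "L' \<in> fin_subsets G" using L by (auto simp: L'_def fin_subsets_def)
  have KF0: "K <#> set_inv F0 \<in> fin_subsets G" by (intro fin_subsets_set_mult fin_subsets_set_inv K F0)
  then have M: "M \<in> fin_subsets G" unfolding M_def by (intro fin_subsets_Un L')
  \<comment> \<open>At most \<open>1 + card L'\<close> times the defect of invariance many
    translates are bad, each costing at most \<open>card F0 * ln (card A)\<close>; this choice makes
    their total at most \<open>\<epsilon> * card F * card F0\<close>. The summand 1 next to the
    logarithm keeps the denominator positive when \<open>A\<close> is a single letter.\<close>
  define \<delta> where "\<delta> = \<epsilon> / ((1 + card L') * (1 + ln (card A)))"
  have lnA: "ln (card A) \<ge> 0" using card_A_pos by simp
  then have \<delta>: "\<delta> > 0" using \<epsilon> by (simp add: \<delta>_def)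
  have "ln (card (S F)) / card F \<le> ln (card (patterns X F0)) / card F0 + \<epsilon>"
    if F: "F \<in> fin_subsets G" and inv: "real (card (sym_diff (F <#> M) F)) < \<delta> * real (card F)" for F
  proof -
    define J where "J = D F <#> set_inv F0"
    define good where "good = {g \<in> F. g <# L' \<subseteq> F}"
    let ?T = "\<lambda>g. (\<lambda>x. restrict x ((g <# F0) \<inter> D F)) ` S F"
    note FD = fin_subsetsD[OF F] and F0D = fin_subsetsD[OF F0]
    have FKf: "F <#> K \<in> fin_subsets G" by (intro fin_subsets_set_mult F K)
    have DG: "D F \<subseteq> carrier G" and finD: "finite (D F)"
      using D[OF F] fin_subsetsD[OF FKf] by (auto intro: finite_subset)
    have KG: "K \<subseteq> carrier G" and L'G: "L' \<subseteq> carrier G" using K L' fin_subsetsD by auto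
    have iF0: "set_inv F0 \<in> fin_subsets G" by (intro fin_subsets_set_inv F0)
    note iF0D = fin_subsetsD[OF iF0]
    have finJ: "finite J" using finD iF0D(2) by (simp add: J_def set_mult_def)
    have JM: "J \<subseteq> F <#> M"
    proof -
      have "J \<subseteq> (F <#> K) <#> set_inv F0" unfolding J_def by (rule mono_set_mult[OF D[OF F] subset_refl])
      also have "\<dots> = F <#> (K <#> set_inv F0)" using FD KG iF0D by (intro set_mult_assoc) auto
      also have "\<dots> \<subseteq> F <#> M" by (auto simp: M_def set_mult_def)
      finally show ?thesis .
    qed
    have fins: "finite (sym_diff (F <#> M) F)"
      using fin_subsetsD[OF fin_subsets_set_mult[OF F M]] FD by auto
    have finS: "finite (S F)"
      using S(1)[OF F] finite_PiE[OF finD, of "\<lambda>_. A"] finite_A finite_subset by blast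
    have card_co: "card (g <# F0) \<le> card F0" for g
      using F0D card_image_le[of F0 "\<lambda>h. g \<otimes> h"] by (simp add: l_coset_def UNION_singleton_eq_range)
    have Tpos: "card (?T g) > 0" for g using finS S(2)[OF F] by (auto simp: card_gt_0_iff)
    \<comment> \<open>Deep inside, \<open>loc\<close> replaces \<open>x\<close> by a point of
      \<open>X\<close> on the translate, so the patterns seen there are restrictions of patterns of
      \<open>X\<close> on \<open>g <# F0\<close>.\<close>
    have T_good: "ln (card (?T g)) \<le> ln (card (patterns X F0))" if "g \<in> good" for g
    proof -
      have gF: "g \<in> F" "g <# L \<subseteq> F" using that by (auto simp: good_def L'_def l_coset_def)
      then have g: "g \<in> carrier G" using FD by auto
      have gF0: "g <# F0 \<in> fin_subsets G" using g F0 by (rule fin_subsets_l_coset)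
      have "?T g \<subseteq> (\<lambda>p. restrict p (D F)) ` patterns X (g <# F0)"
      proof
        fix p assume "p \<in> ?T g"
        then obtain x where x: "x \<in> S F" "p = restrict x ((g <# F0) \<inter> D F)" by auto
        obtain z where z: "z \<in> X" "\<forall>t\<in>(g <# F0) \<inter> D F. x t = z t"
          using loc[OF F g gF(2) x(1)] by auto
        have p: "p = restrict (restrict z (g <# F0)) (D F)" unfolding x(2) using z by auto
        show "p \<in> (\<lambda>p. restrict p (D F)) ` patterns X (g <# F0)"
          unfolding p patterns_def using z(1) by blast
      qed
      then have "card (?T g) \<le> card (patterns X (g <# F0))"
        using finite_patterns[OF X(1) gF0] by (rule surj_card_le[rotated])
      also have "\<dots> \<le> card (patterns X F0)" by (rule card_patterns_l_coset_le[OF X(1,2) F0 g])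
      finally show ?thesis using Tpos[of g] by simp
    qed
    have T_any: "ln (card (?T g)) \<le> card F0 * ln (card A)" for g
    proof -
      have finE: "finite ((g <# F0) \<inter> D F)" using finD by simp
      have cE: "card ((g <# F0) \<inter> D F) \<le> card F0"
        using card_co[of g] F0D by (intro order_trans[OF card_mono card_co]) (auto simp: l_coset_def)
      have "?T g \<subseteq> ((g <# F0) \<inter> D F) \<rightarrow>\<^sub>E A"
        by (rule image_subsetI, drule subsetD[OF S(1)[OF F]]) (simp add: PiE_iff)
      then have "card (?T g) \<le> card (((g <# F0) \<inter> D F) \<rightarrow>\<^sub>E A)"
        using finE finite_A by (intro card_mono finite_PiE) auto
      also have "\<dots> = card A ^ card ((g <# F0) \<inter> D F)" using finE by (simp add: card_PiE)
      also have "\<dots> \<le> card A ^ card F0" using card_A_pos cE by (intro power_increasing) auto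
      finally have "ln (card (?T g)) \<le> ln (real (card A ^ card F0))"
        using Tpos[of g] by (subst ln_le_cancel_iff) (auto simp: card_A_pos)
      also have "\<dots> = card F0 * ln (card A)" using card_A_pos by (simp add: ln_realpow)
      finally show ?thesis .
    qed
    have bad: "card (J - good) \<le> (1 + card L') * card (sym_diff (F <#> M) F)"
    proof -
      have "J - good \<subseteq> sym_diff (F <#> M) F \<union> {g \<in> F. \<not> g <# L' \<subseteq> F}"
        using JM by (auto simp: good_def)
      then have "card (J - good) \<le> card (sym_diff (F <#> M) F \<union> {g \<in> F. \<not> g <# L' \<subseteq> F})"
        using fins FD by (intro card_mono) auto
      also have "\<dots> \<le> card (sym_diff (F <#> M) F) + card {g \<in> F. \<not> g <# L' \<subseteq> F}" by (rule card_Un_le)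
      also have "card {g \<in> F. \<not> g <# L' \<subseteq> F} \<le> card L' * card (sym_diff (F <#> M) F)"
        by (rule card_right_boundary_le[OF F L' M]) (simp add: M_def)
      finally show ?thesis by simp
    qed
    have cover: "card {g \<in> J. t \<in> g <# F0} = card F0" if "t \<in> D F" for t
      unfolding J_def by (rule card_translates_containing[OF DG F0 that])
    have lnX: "ln (card (patterns X F0)) \<ge> 0"
      using finite_patterns[OF X(1) F0] X(3) by (auto simp: patterns_def Suc_le_eq card_gt_0_iff)
    \<comment> \<open>The multiplicity \<open>card F0\<close> on the left cancels in the end: at
      most \<open>card F\<close> translates are good, so the average cost per point is the rate at
      \<open>F0\<close>.\<close>
    have "card F0 * ln (card (S F)) \<le> (\<Sum>g\<in>J. ln (card (?T g)))"
      using S(1)[OF F] by (intro Shearer[OF finS S(2)[OF F] _ finJ finD cover]) (auto simp: PiE_def)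
    also have "\<dots> = (\<Sum>g\<in>J \<inter> good. ln (card (?T g))) + (\<Sum>g\<in>J - good. ln (card (?T g)))"
      using finJ by (rule sum.Int_Diff)
    also have "\<dots> \<le> (\<Sum>g\<in>J \<inter> good. ln (card (patterns X F0))) + (\<Sum>g\<in>J - good. card F0 * ln (card A))"
      by (intro add_mono sum_mono T_good T_any) auto
    also have "\<dots> = card (J \<inter> good) * ln (card (patterns X F0)) + card (J - good) * (card F0 * ln (card A))"
      by simp
    also have "\<dots> \<le> card F * ln (card (patterns X F0)) + (\<epsilon> * card F) * card F0"
    proof (rule add_mono)
      have "card (J \<inter> good) \<le> card F" using FD by (intro card_mono) (auto simp: good_def)
      then show "card (J \<inter> good) * ln (card (patterns X F0)) \<le> card F * ln (card (patterns X F0))"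
        using lnX by (intro mult_right_mono) auto
      have "real (card (J - good)) * ln (card A) \<le> real (card (J - good)) * (1 + ln (card A))"
        by (intro mult_left_mono) auto
      also have "\<dots> \<le> real ((1 + card L') * card (sym_diff (F <#> M) F)) * (1 + ln (card A))"
        using bad lnA by (intro mult_right_mono) (auto simp del: of_nat_mult of_nat_add)
      also have "\<dots> = ((1 + card L') * (1 + ln (card A))) * card (sym_diff (F <#> M) F)"
          by (simp add: algebra_simps)
      also have "\<dots> \<le> ((1 + card L') * (1 + ln (card A))) * (\<delta> * card F)"
        using lnA inv by (intro mult_left_mono) auto
      also have "\<dots> = \<epsilon> * card F"
      proof -
        have "(1 + real (card L')) * (1 + ln (card A)) \<noteq> 0" using lnA by auto
        then show ?thesis unfolding \<delta>_def by simp
      qed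
      finally have "(real (card (J - good)) * ln (card A)) * card F0 \<le> (\<epsilon> * card F) * card F0"
        by (intro mult_right_mono) auto
      then show "card (J - good) * (card F0 * ln (card A)) \<le> (\<epsilon> * card F) * card F0"
        by (simp add: mult_ac)
    qed
    finally show ?thesis using FD F0D by (simp add: field_simps)
  qed
  then show ?thesis
    unfolding eventually_folner using M \<delta> by (intro bexI[of _ M] exI[of _ \<delta>]) auto
qed

end

section \<open>Entropy of subshifts\<close>

context amenable_alphabet begin

definition pattern_rate :: "('a \<Rightarrow> 'a) set \<Rightarrow> real" where
  "pattern_rate X = (INF F \<in> fin_subsets G. ln (card (patterns X F)) / card F)"

text \<open>\<open>D F\<close> is the set on which the configurations in \<open>S F\<close> live,
  and \<open>K\<close> keeps it within bounded distance of \<open>F\<close>. The depth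
  \<open>L\<close> depends on the window \<open>F0\<close> alone, uniformly in \<open>F\<close>,
  \<open>g\<close> and \<open>x\<close>. The intersection with \<open>D F\<close> is there because
  the translate may stick out of the domain.\<close>

definition locally_modelled :: "('a \<Rightarrow> 'a) set \<Rightarrow> ('a set \<Rightarrow> 'a set) \<Rightarrow> ('a set \<Rightarrow> ('a \<Rightarrow> 'a) set) \<Rightarrow> bool"
  where "locally_modelled X D S \<longleftrightarrow>
    (\<forall>F\<in>fin_subsets G. S F \<subseteq> D F \<rightarrow>\<^sub>E A) \<and> (\<exists>K\<in>fin_subsets G. \<forall>F\<in>fin_subsets G. D F \<subseteq> F <#> K) \<and>
    (\<forall>F0\<in>fin_subsets G. \<exists>L\<in>fin_subsets G. \<forall>F\<in>fin_subsets G. \<forall>g\<in>carrier G. g <# L \<subseteq> F \<longrightarrow>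
      (\<forall>x\<in>S F. \<exists>z\<in>X. \<forall>t\<in>(g <# F0) \<inter> D F. x t = z t))"

lemma fin_subsets_ne: "fin_subsets G \<noteq> {}"
  using A_fin_subsets by blast

lemma pattern_ln_nonneg: "0 \<le> ln (card (patterns X F))"
  by (cases "card (patterns X F)") auto

lemma pattern_rate_bdd: "bdd_below ((\<lambda>F. ln (card (patterns X F)) / card F) ` fin_subsets G)"
  by (intro bdd_belowI2[of _ 0] divide_nonneg_nonneg pattern_ln_nonneg) auto

lemma pattern_rate_le: "F \<in> fin_subsets G \<Longrightarrow> pattern_rate X \<le> ln (card (patterns X F)) / card F"
  unfolding pattern_rate_def by (rule cINF_lower[OF pattern_rate_bdd])

lemma pattern_rate_nonneg: "0 \<le> pattern_rate X"
  unfolding pattern_rate_def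
  by (intro cINF_greatest fin_subsets_ne divide_nonneg_nonneg pattern_ln_nonneg) auto

text \<open>The rate is nonnegative, so a bound on its product with \<open>card F'\<close> is also
  one on its product with the smaller \<open>card F\<close>. This permits counting on a larger
  window while dividing by the size of \<open>F\<close>.\<close>

lemma pattern_rate_le_extension:
  assumes "F \<in> fin_subsets G" "F' \<in> fin_subsets G" "card F \<le> card F'"
    and "card (patterns X F') \<le> n" "X \<noteq> {}" "X \<subseteq> carrier G \<rightarrow>\<^sub>E A"
  shows "pattern_rate X \<le> ln n / card F"
proof -
  have pos: "card (patterns X F') > 0"
    using assms finite_patterns by (auto simp: card_gt_0_iff patterns_def)
  have "pattern_rate X * card F \<le> pattern_rate X * card F'"
    using assms pattern_rate_nonneg by (intro mult_left_mono) auto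
  also have "\<dots> \<le> ln (card (patterns X F'))"
    using pattern_rate_le[OF assms(2), of X] fin_subsetsD(4)[OF assms(2)] by (simp add: field_simps)
  also have "\<dots> \<le> ln n" using pos assms(4) by simp
  finally show ?thesis using fin_subsetsD(4)[OF assms(1)] by (simp add: field_simps)
qed

lemma log_nat_div: "0 < n \<Longrightarrow> 0 < r \<Longrightarrow> log_nat n / ereal r = ereal (ln n / r)"
  by (simp add: log_nat_def)

lemma folner_fin_subsets: "\<forall>\<^sub>F F in folner G. F \<in> fin_subsets G"
  unfolding eventually_folner using A_fin_subsets by (auto intro!: exI[of _ 1])

lemma folner_ne_bot: "folner G \<noteq> bot"
  using amenable folner_nontrivial by simp

text \<open>The lower bound holds at every \<open>F\<close>. For the upper bound, a window
  \<open>F0\<close> whose quotient is close to the infimum is fed to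
  \<open>eventually_rate_le\<close>.\<close>

lemma rate_tendsto:
  assumes X: "X \<subseteq> carrier G \<rightarrow>\<^sub>E A" "shift_invariant G X" "X \<noteq> {}"
    and S: "locally_modelled X D S" "\<And>F. F \<in> fin_subsets G \<Longrightarrow> 0 < card (S F)"
    and lower: "\<And>F. F \<in> fin_subsets G \<Longrightarrow> pattern_rate X \<le> ln (card (S F)) / card F"
  shows "((\<lambda>F. log_nat (card (S F)) / ereal (real (card F))) \<longlongrightarrow> ereal (pattern_rate X)) (folner G)"
proof -
  have "((\<lambda>F. ln (card (S F)) / card F) \<longlongrightarrow> pattern_rate X) (folner G)"
  proof (rule order_tendstoI)
    fix a assume "a < pattern_rate X"
    with lower show "\<forall>\<^sub>F F in folner G. a < ln (card (S F)) / card F"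
      by (intro eventually_mono[OF folner_fin_subsets]) (rule less_le_trans)
  next
    fix a assume a: "pattern_rate X < a"
    then obtain F0 where F0: "F0 \<in> fin_subsets G" "ln (card (patterns X F0)) / card F0 < a"
      unfolding pattern_rate_def by (subst (asm) cINF_less_iff[OF fin_subsets_ne pattern_rate_bdd]) auto
    \<comment> \<open>Half of the gap leaves the inequality below \<open>a\<close> strict.\<close>
    define \<epsilon> where "\<epsilon> = (a - ln (card (patterns X F0)) / card F0) / 2"
    have \<epsilon>: "\<epsilon> > 0" using F0 by (simp add: \<epsilon>_def)
    have "\<exists>K\<in>fin_subsets G. \<forall>F\<in>fin_subsets G. D F \<subseteq> F <#> K"
      using S(1) unfolding locally_modelled_def by (elim conjE)
    then obtain K where K: "K \<in> fin_subsets G" "\<And>F. F \<in> fin_subsets G \<Longrightarrow> D F \<subseteq> F <#> K" by blast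
    have "\<exists>L\<in>fin_subsets G. \<forall>F\<in>fin_subsets G. \<forall>g\<in>carrier G. g <# L \<subseteq> F \<longrightarrow>
        (\<forall>x\<in>S F. \<exists>z\<in>X. \<forall>t\<in>(g <# F0) \<inter> D F. x t = z t)"
      using S(1) F0(1) unfolding locally_modelled_def by (elim conjE) (rule bspec)
    then obtain L where L: "L \<in> fin_subsets G" "\<forall>F\<in>fin_subsets G. \<forall>g\<in>carrier G. g <# L \<subseteq> F \<longrightarrow>
        (\<forall>x\<in>S F. \<exists>z\<in>X. \<forall>t\<in>(g <# F0) \<inter> D F. x t = z t)" by (elim bexE)
    have SD: "S F \<subseteq> D F \<rightarrow>\<^sub>E A" "S F \<noteq> {}" if "F \<in> fin_subsets G" for F
      using S(1) S(2)[OF that] that unfolding locally_modelled_def by auto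
    have "\<forall>\<^sub>F F in folner G. F \<in> fin_subsets G \<and>
      ln (card (S F)) / card F \<le> ln (card (patterns X F0)) / card F0 + \<epsilon>"
      by (rule eventually_rate_le[OF X F0(1) K(1) L(1) SD K(2) L(2)[rule_format] \<epsilon>])
    then show "\<forall>\<^sub>F F in folner G. ln (card (S F)) / card F < a"
      by eventually_elim (use F0 in \<open>simp add: \<epsilon>_def field_simps\<close>)
  qed
  then have "((\<lambda>F. ereal (ln (card (S F)) / card F)) \<longlongrightarrow> ereal (pattern_rate X)) (folner G)"
    by (rule tendsto_ereal)
  moreover have "\<forall>\<^sub>F F in folner G. ereal (ln (card (S F)) / card F) = log_nat (card (S F)) / ereal (real (card F))"
    using folner_fin_subsets
    by eventually_elim (use S(2) fin_subsetsD(4) in \<open>simp add: log_nat_div\<close>)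
  ultimately show ?thesis by (rule Lim_transform_eventually)
qed

section \<open>Cylinders in the full shift and entropy by open covers\<close>

lemma topspace_full_shift: "topspace (full_shift_topology G A) = carrier G \<rightarrow>\<^sub>E A"
  by (simp add: full_shift_topology_def)

lemma compact_full_shift: "compact_space (full_shift_topology G A)"
  using finite_A by (auto simp: full_shift_topology_def compact_space_product_topology compact_space_discrete_topology)

text \<open>Such a set is a union of cylinders over \<open>K\<close>. The condition on
  \<open>Q\<close> is symmetric in the two points, so the complement is open as well.\<close>

lemma openin_finite_coords:
  assumes K: "K \<in> fin_subsets G"
    and Q: "\<And>x y. x \<in> carrier G \<rightarrow>\<^sub>E A \<Longrightarrow> y \<in> carrier G \<rightarrow>\<^sub>E A \<Longrightarrow> \<forall>k\<in>K. x k = y k \<Longrightarrow> Q x \<Longrightarrow> Q y"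
  shows "openin (full_shift_topology G A) {x \<in> carrier G \<rightarrow>\<^sub>E A. Q x}"
  unfolding full_shift_topology_def openin_product_topology_alt
proof (intro ballI)
  fix x assume x: "x \<in> {x \<in> carrier G \<rightarrow>\<^sub>E A. Q x}"
  define U where "U = (\<lambda>i. if i \<in> K then {x i} else A)"
  have "finite {i \<in> carrier G. U i \<noteq> topspace (discrete_topology A)}"
    by (rule finite_subset[OF _ fin_subsetsD(2)[OF K]]) (auto simp: U_def)
  moreover have "\<forall>i\<in>carrier G. openin (discrete_topology A) (U i)"
    using x by (auto simp: U_def)
  moreover have "x \<in> Pi\<^sub>E (carrier G) U" using x by (auto simp: U_def PiE_def)
  moreover have "Pi\<^sub>E (carrier G) U \<subseteq> {x \<in> carrier G \<rightarrow>\<^sub>E A. Q x}"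
  proof
    fix y assume y: "y \<in> Pi\<^sub>E (carrier G) U"
    have "U i \<subseteq> A" if "i \<in> carrier G" for i using x that by (auto simp: U_def)
    then have yA: "y \<in> carrier G \<rightarrow>\<^sub>E A" using y PiE_mono[of "carrier G" U "\<lambda>_. A"] by blast
    have "\<forall>k\<in>K. x k = y k"
    proof
      fix k assume k: "k \<in> K"
      then have "y k \<in> U k" using y fin_subsetsD(1)[OF K] by (auto simp: PiE_def Pi_def)
      then show "x k = y k" using k by (simp add: U_def)
    qed
    then show "y \<in> {x \<in> carrier G \<rightarrow>\<^sub>E A. Q x}" using Q[of x y] x yA by auto
  qed
  ultimately show "\<exists>U. finite {i \<in> carrier G. U i \<noteq> topspace (discrete_topology A)} \<and>
      (\<forall>i\<in>carrier G. openin (discrete_topology A) (U i)) \<and> x \<in> Pi\<^sub>E (carrier G) U \<and>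
      Pi\<^sub>E (carrier G) U \<subseteq> {x \<in> carrier G \<rightarrow>\<^sub>E A. Q x}" by blast
qed

lemma open_contains_cylinder:
  assumes W: "openin (full_shift_topology G A) W" and x: "x \<in> W"
  obtains K where "K \<in> fin_subsets G" "{y \<in> carrier G \<rightarrow>\<^sub>E A. \<forall>k\<in>K. y k = x k} \<subseteq> W"
proof -
  obtain U where U: "finite {i \<in> carrier G. U i \<noteq> A}" "x \<in> Pi\<^sub>E (carrier G) U" "Pi\<^sub>E (carrier G) U \<subseteq> W"
    using W x unfolding full_shift_topology_def openin_product_topology_alt by auto
  \<comment> \<open>The identity is inserted because members of \<open>fin_subsets G\<close> must be
    nonempty, and no coordinate need be constrained by \<open>U\<close>.\<close>
  define K where "K = insert \<one> {i \<in> carrier G. U i \<noteq> A}"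
  have "{y \<in> carrier G \<rightarrow>\<^sub>E A. \<forall>k\<in>K. y k = x k} \<subseteq> Pi\<^sub>E (carrier G) U"
  proof
    fix y assume y: "y \<in> {y \<in> carrier G \<rightarrow>\<^sub>E A. \<forall>k\<in>K. y k = x k}"
    have "y i \<in> U i" if i: "i \<in> carrier G" for i
    proof (cases "U i = A")
      case True then show ?thesis using y i by auto
    next
      case False
      then have "y i = x i" using y i by (auto simp: K_def)
      then show ?thesis using U(2) i by auto
    qed
    then show "y \<in> Pi\<^sub>E (carrier G) U" using y by (auto simp: PiE_def)
  qed
  then show ?thesis
    using U that[of K] by (auto simp: K_def fin_subsets_def)
qed

text \<open>The Lebesgue number lemma with windows in place of radii: compactness leaves finitely
  many cylinders, each inside a member of the cover, and the union of their windows serves all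
  points.\<close>

lemma Lebesgue_cylinder:
  assumes X: "closedin (full_shift_topology G A) X"
    and U: "U \<in> open_covers (subtopology (full_shift_topology G A) X)"
  shows "\<exists>K\<in>fin_subsets G. \<forall>x\<in>X. \<exists>V\<in>U. {y \<in> X. \<forall>k\<in>K. y k = x k} \<subseteq> V"
proof -
  let ?T = "subtopology (full_shift_topology G A) X"
  have XA: "X \<subseteq> carrier G \<rightarrow>\<^sub>E A" using X closedin_subset topspace_full_shift by blast
  then have top: "topspace ?T = X" by (auto simp: topspace_full_shift)
  have "\<exists>K V. K \<in> fin_subsets G \<and> V \<in> U \<and> {y \<in> X. \<forall>k\<in>K. y k = x k} \<subseteq> V" if x: "x \<in> X" for x
  proof -
    obtain V where V: "V \<in> U" "x \<in> V" using U x unfolding open_covers_def top by blast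
    then obtain W where W: "openin (full_shift_topology G A) W" "V = W \<inter> X"
      using U by (auto simp: open_covers_def openin_subtopology)
    then obtain K where "K \<in> fin_subsets G" "{y \<in> carrier G \<rightarrow>\<^sub>E A. \<forall>k\<in>K. y k = x k} \<subseteq> W"
      using open_contains_cylinder V by blast
    then show ?thesis using V W XA by blast
  qed
  then have "\<forall>x\<in>X. \<exists>K. \<exists>V. K \<in> fin_subsets G \<and> V \<in> U \<and> {y \<in> X. \<forall>k\<in>K. y k = x k} \<subseteq> V" by blast
  from bchoice[OF this] obtain K where
    KV: "\<And>x. x \<in> X \<Longrightarrow> \<exists>V. K x \<in> fin_subsets G \<and> V \<in> U \<and> {y \<in> X. \<forall>k\<in>K x. y k = x k} \<subseteq> V"
    by blast
  define C where "C x = {y \<in> X. \<forall>k\<in>K x. y k = x k}" for x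
  have "openin ?T (C x)" if "x \<in> X" for x
  proof -
    have "openin (full_shift_topology G A) {y \<in> carrier G \<rightarrow>\<^sub>E A. \<forall>k\<in>K x. y k = x k}"
      using KV[OF that] by (intro openin_finite_coords[of "K x"]; force)
    moreover have "C x = {y \<in> carrier G \<rightarrow>\<^sub>E A. \<forall>k\<in>K x. y k = x k} \<inter> X" using XA by (auto simp: C_def)
    ultimately show ?thesis unfolding openin_subtopology by blast
  qed
  then have "\<forall>V\<in>C ` X. openin ?T V" by blast
  moreover have "compact_space ?T"
    using closedin_compact_space[OF compact_full_shift X] by (simp add: compact_space_subtopology)
  moreover have "X \<subseteq> \<Union> (C ` X)" by (auto simp: C_def)
  ultimately have "\<exists>\<F>. finite \<F> \<and> \<F> \<subseteq> C ` X \<and> X \<subseteq> \<Union>\<F>"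
    unfolding compact_space_alt top by blast
  then obtain \<F> where \<F>: "finite \<F>" "\<F> \<subseteq> C ` X" "X \<subseteq> \<Union>\<F>" by blast
  then obtain X0 where X0: "X0 \<subseteq> X" "finite X0" "\<F> = C ` X0" by (meson finite_subset_image)
  define L where "L = insert \<one> (\<Union>x\<in>X0. K x)"
  have L: "L \<in> fin_subsets G"
  proof -
    have "K x \<subseteq> carrier G \<and> finite (K x)" if "x \<in> X0" for x
      using KV X0(1) that fin_subsetsD(1,2) by blast
    then show ?thesis using X0(2) unfolding L_def fin_subsets_def by auto
  qed
  have cov: "\<exists>V\<in>U. {y \<in> X. \<forall>k\<in>L. y k = x k} \<subseteq> V" if x: "x \<in> X" for x
  proof -
    obtain w where w: "w \<in> X0" "x \<in> C w" using \<F> X0 x by auto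
    then have "{y \<in> X. \<forall>k\<in>L. y k = x k} \<subseteq> C w" by (auto simp: C_def L_def)
    moreover obtain V where "V \<in> U" "C w \<subseteq> V" using KV[of w] w X0 unfolding C_def by blast
    ultimately show ?thesis by blast
  qed
  show ?thesis by (rule bexI[OF _ L], rule ballI, rule cov)
qed

text \<open>\<open>shift G (inv s) y\<close> takes at \<open>k\<close> the value of \<open>y\<close>
  at \<open>s \<otimes> k\<close>. Hence the pattern of \<open>y\<close> on \<open>F <#> K\<close>,
  with \<open>K\<close> a Lebesgue window, fixes for every \<open>s\<close> in \<open>F\<close> a
  member of \<open>U\<close> containing \<open>shift G (inv s) y\<close>, and one member of the join
  per pattern suffices.\<close>

lemma cover_join_subcover:
  assumes X: "closedin (full_shift_topology G A) X" "shift_invariant G X"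
    and U: "U \<in> open_covers (subtopology (full_shift_topology G A) X)"
  shows "\<exists>K\<in>fin_subsets G. \<forall>F\<in>fin_subsets G.
    \<exists>V \<subseteq> cover_join (subtopology (full_shift_topology G A) X) (shift G) U F.
      finite V \<and> card V \<le> card (patterns X (F <#> K)) \<and> \<Union>V = X"
proof -
  let ?T = "subtopology (full_shift_topology G A) X"
  have XA: "X \<subseteq> carrier G \<rightarrow>\<^sub>E A" using X closedin_subset topspace_full_shift by blast
  then have top: "topspace ?T = X" by (auto simp: topspace_full_shift)
  obtain K where K: "K \<in> fin_subsets G" "\<forall>x\<in>X. \<exists>V\<in>U. {y \<in> X. \<forall>k\<in>K. y k = x k} \<subseteq> V"
    using Lebesgue_cylinder[OF X(1) U] by (elim bexE)
  then have "\<forall>x\<in>X. \<exists>V. V \<in> U \<and> {y \<in> X. \<forall>k\<in>K. y k = x k} \<subseteq> V" by blast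
  from bchoice[OF this] obtain V where
    V: "\<And>x. x \<in> X \<Longrightarrow> V x \<in> U \<and> {y \<in> X. \<forall>k\<in>K. y k = x k} \<subseteq> V x" by blast
  show ?thesis
  proof (rule bexI[OF ballI K(1)])
    fix F assume F: "F \<in> fin_subsets G"
    let ?P = "patterns X (F <#> K)"
    have "\<forall>p\<in>?P. \<exists>x. x \<in> X \<and> restrict x (F <#> K) = p" by (auto simp: patterns_def)
    from bchoice[OF this] obtain r where
      r: "\<And>p. p \<in> ?P \<Longrightarrow> r p \<in> X \<and> restrict (r p) (F <#> K) = p" by blast
    \<comment> \<open>The member attached to a pattern is chosen through the representative
      \<open>r p\<close>; every other point with that pattern falls into the same sets.\<close>
    define W where "W p = X \<inter> (\<Inter>s\<in>F. shift G s ` V (shift G (inv s) (r p)))" for p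
    have sh: "shift G (inv s) x \<in> X" if "s \<in> F" "x \<in> X" for s x
      using X(2) that fin_subsetsD(1)[OF F] unfolding shift_invariant_def by auto
    have "W ` ?P \<subseteq> cover_join ?T (shift G) U F"

    proof (rule image_subsetI)
      fix p assume p: "p \<in> ?P"
      have "(\<lambda>s. V (shift G (inv s) (r p))) \<in> F \<rightarrow> U"
      proof (rule Pi_I)
        fix s assume s: "s \<in> F"
        have "r p \<in> X" using r[OF p] by simp
        then show "V (shift G (inv s) (r p)) \<in> U" using V[OF sh[OF s]] by simp
      qed
      then show "W p \<in> cover_join ?T (shift G) U F"
        unfolding cover_join_def top W_def by (intro CollectI exI[of _ "\<lambda>s. V (shift G (inv s) (r p))"]) simp
    qed
    moreover have "finite (W ` ?P)" "card (W ` ?P) \<le> card ?P"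
      using finite_patterns[OF XA fin_subsets_set_mult[OF F K(1)]] by (simp_all add: card_image_le)
    moreover have yW: "y \<in> W (restrict y (F <#> K))" if y: "y \<in> X" for y
    proof -
      let ?p = "restrict y (F <#> K)"
      have p: "?p \<in> ?P" using y by (auto simp: patterns_def)
      have "y \<in> shift G s ` V (shift G (inv s) (r ?p))" if s: "s \<in> F" for s
      proof -
        have sG: "s \<in> carrier G" using s fin_subsetsD(1)[OF F] by auto
        have "shift G (inv s) y k = shift G (inv s) (r ?p) k" if k: "k \<in> K" for k
        proof -
          have kG: "k \<in> carrier G" using k fin_subsetsD(1)[OF K(1)] by auto
          have sk: "s \<otimes> k \<in> F <#> K" using s k by (auto simp: set_mult_def)
          have "r ?p (s \<otimes> k) = y (s \<otimes> k)"
            using r[OF p] sk by (metis restrict_apply')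
          then show ?thesis using sG kG by (simp add: shift_apply)
        qed
        then have "shift G (inv s) y \<in> {z \<in> X. \<forall>k\<in>K. z k = shift G (inv s) (r ?p) k}"
          using sh[OF s y] by simp
        moreover have "r ?p \<in> X" using r[OF p] by simp
        ultimately have "shift G (inv s) y \<in> V (shift G (inv s) (r ?p))"
          using V[OF sh[OF s]] by (meson subsetD)
        then have "shift G s (shift G (inv s) y) \<in> shift G s ` V (shift G (inv s) (r ?p))" by blast
        moreover have "shift G s (shift G (inv s) y) = y" using y XA by (intro shift_shift_inv[OF sG]) blast
        ultimately show ?thesis by simp
      qed
      then show ?thesis using y by (simp add: W_def)
    qed
    have "\<Union> (W ` ?P) = X"
    proof
      show "\<Union> (W ` ?P) \<subseteq> X" by (auto simp: W_def)
      show "X \<subseteq> \<Union> (W ` ?P)"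
      proof
        fix y assume y: "y \<in> X"
        then have "restrict y (F <#> K) \<in> ?P" by (simp add: patterns_def)
        with yW[OF y] show "y \<in> \<Union> (W ` ?P)" by blast
      qed
    qed
    ultimately show "\<exists>V \<subseteq> cover_join ?T (shift G) U F.
      finite V \<and> card V \<le> card ?P \<and> \<Union>V = X" by blast
  qed
qed

lemma log_nat_mono: "m \<le> n \<Longrightarrow> log_nat m \<le> log_nat n"
  by (simp add: log_nat_def)

lemma le_card_set_mult:
  assumes F: "F \<in> fin_subsets G" and K: "K \<in> fin_subsets G"
  shows "card F \<le> card (F <#> K)"
proof -
  obtain k where k: "k \<in> K" "k \<in> carrier G" using fin_subsetsD[OF K] by blast
  have "inj_on (\<lambda>s. s \<otimes> k) F"
    by (rule inj_onI) (use fin_subsetsD(1)[OF F] k right_cancel in blast)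
  moreover have "(\<lambda>s. s \<otimes> k) ` F \<subseteq> F <#> K" using k by (auto simp: set_mult_def)
  ultimately show ?thesis
    using fin_subsetsD(2)[OF fin_subsets_set_mult[OF F K]] by (rule card_inj_on_le)
qed

text \<open>Here the point of \<open>X\<close> that was restricted serves for every window, at any
  depth.\<close>

lemma locally_modelled_patterns:
  assumes X: "X \<subseteq> carrier G \<rightarrow>\<^sub>E A" and K: "K \<in> fin_subsets G"
  shows "locally_modelled X (\<lambda>F. F <#> K) (\<lambda>F. patterns X (F <#> K))"
proof -
  have "patterns X (F <#> K) \<subseteq> (F <#> K) \<rightarrow>\<^sub>E A" if "F \<in> fin_subsets G" for F
    using patterns_subset[OF X] fin_subsetsD(1)[OF fin_subsets_set_mult[OF that K]] .
  moreover have "\<exists>z\<in>X. \<forall>t\<in>(g <# F0) \<inter> (F <#> K). x t = z t" if "x \<in> patterns X (F <#> K)" for x g F0 F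
    using that by (auto simp: patterns_def)
  ultimately show ?thesis using K unfolding locally_modelled_def by blast
qed

text \<open>From above, a join over \<open>F\<close> needs no more members than there are patterns
  on \<open>F <#> K\<close>, and enlarging by a fixed \<open>K\<close> leaves the rate unchanged by
  \<open>rate_tendsto\<close>. From below, a single cover already separates all patterns.\<close>

lemma shift_entropy_eq_pattern_rate:
  assumes X: "closedin (full_shift_topology G A) X" "shift_invariant G X" "X \<noteq> {}"
  shows "shift_entropy G A X = ereal (pattern_rate X)"
proof -
  let ?T = "subtopology (full_shift_topology G A) X"
  have XA: "X \<subseteq> carrier G \<rightarrow>\<^sub>E A" using X closedin_subset topspace_full_shift by blast
  then have top: "topspace ?T = X" by (auto simp: topspace_full_shift)
  have upper: "cover_entropy G ?T (shift G) U \<le> ereal (pattern_rate X)" if U: "U \<in> open_covers ?T" for U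
  proof -
    obtain K where K: "K \<in> fin_subsets G" and sub: "\<forall>F\<in>fin_subsets G.
      \<exists>V \<subseteq> cover_join ?T (shift G) U F. finite V \<and> card V \<le> card (patterns X (F <#> K)) \<and> \<Union>V = X"
      using cover_join_subcover[OF X(1,2) U] by (elim bexE)
    have "min_subcover ?T (cover_join ?T (shift G) U F) \<le> card (patterns X (F <#> K))"
      if F: "F \<in> fin_subsets G" for F
    proof -
      obtain V where V: "V \<subseteq> cover_join ?T (shift G) U F" "finite V"
          "card V \<le> card (patterns X (F <#> K))" "\<Union>V = X"
        using bspec[OF sub F] by blast
      have "min_subcover ?T (cover_join ?T (shift G) U F) \<le> card V"
        unfolding min_subcover_def top using V by (intro Least_le) auto
      then show ?thesis using V(3) by simp
    qed
    then have "\<forall>\<^sub>F F in folner G. log_nat (min_subcover ?T (cover_join ?T (shift G) U F)) / ereal (real (card F))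
        \<le> log_nat (card (patterns X (F <#> K))) / ereal (real (card F))"
      using folner_fin_subsets
      by (auto elim!: eventually_mono intro!: ereal_divide_right_mono log_nat_mono dest: fin_subsetsD(4))
    then have "cover_entropy G ?T (shift G) U
        \<le> Limsup (folner G) (\<lambda>F. log_nat (card (patterns X (F <#> K))) / ereal (real (card F)))"
      unfolding cover_entropy_def by (rule Limsup_mono)
    also have "\<dots> = ereal (pattern_rate X)"
    proof (rule lim_imp_Limsup[OF folner_ne_bot rate_tendsto[OF XA X(2,3) locally_modelled_patterns[OF XA K]]])
      fix F assume F: "F \<in> fin_subsets G"
      note FK = fin_subsets_set_mult[OF F K]
      show "0 < card (patterns X (F <#> K))"
        using finite_patterns[OF XA FK] X(3) by (auto simp: card_gt_0_iff patterns_def)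
      show "pattern_rate X \<le> ln (card (patterns X (F <#> K))) / card F"
        using pattern_rate_le_extension[OF F FK le_card_set_mult[OF F K] _ X(3) XA] by blast
    qed
    finally show ?thesis .
  qed
  \<comment> \<open>The partition by the letter at the identity: translated by \<open>s\<close> it
    reads the letter at \<open>s\<close>, so its join over \<open>F\<close> is the partition into
    patterns on \<open>F\<close>.\<close>
  define U0 where "U0 = (\<lambda>a. {x \<in> X. x \<one> = a}) ` A"
  have U0: "U0 \<in> open_covers ?T"
  proof -
    have "openin ?T {x \<in> X. x \<one> = a}" for a
    proof -
      have "openin (full_shift_topology G A) {x \<in> carrier G \<rightarrow>\<^sub>E A. x \<one> = a}"
        by (intro openin_finite_coords[of "{\<one>}"]) (auto simp: fin_subsets_singleton)
      moreover have "{x \<in> X. x \<one> = a} = {x \<in> carrier G \<rightarrow>\<^sub>E A. x \<one> = a} \<inter> X" using XA by auto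
      ultimately show ?thesis by (auto simp: openin_subtopology)
    qed
    moreover have "\<Union>U0 = X" using XA by (auto simp: U0_def)
    ultimately show ?thesis unfolding open_covers_def top by (auto simp: U0_def)
  qed
  \<comment> \<open>Only the existence of a finite subcover matters here; it makes the least number
    in \<open>min_subcover\<close> an attained one.\<close>
  obtain K where K: "K \<in> fin_subsets G" and sub: "\<forall>F\<in>fin_subsets G.
    \<exists>V \<subseteq> cover_join ?T (shift G) U0 F. finite V \<and> card V \<le> card (patterns X (F <#> K)) \<and> \<Union>V = X"
    using cover_join_subcover[OF X(1,2) U0] by (elim bexE)
  have min_ge: "card (patterns X F) \<le> min_subcover ?T (cover_join ?T (shift G) U0 F)"
    if F: "F \<in> fin_subsets G" for F
  proof -
    have "\<exists>n. \<exists>V \<subseteq> cover_join ?T (shift G) U0 F. finite V \<and> card V = n \<and> \<Union>V = X"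
      using bspec[OF sub F] by blast
    then have "\<exists>V \<subseteq> cover_join ?T (shift G) U0 F. finite V \<and>
        card V = min_subcover ?T (cover_join ?T (shift G) U0 F) \<and> \<Union>V = X"
      unfolding min_subcover_def top by (rule LeastI_ex)
    then obtain V where V: "V \<subseteq> cover_join ?T (shift G) U0 F" "finite V"
        "card V = min_subcover ?T (cover_join ?T (shift G) U0 F)" "\<Union>V = X"
      by blast
    have atom: "restrict x F = restrict y F" if "v \<in> V" "x \<in> v" "y \<in> v" for v x y
    proof -
      obtain c where c: "c \<in> F \<rightarrow> U0" "v = X \<inter> (\<Inter>s\<in>F. shift G s ` c s)"
        using V(1) \<open>v \<in> V\<close> unfolding cover_join_def top by blast
      have "x s = y s" if s: "s \<in> F" for s
      proof -
        have sG: "s \<in> carrier G" using s fin_subsetsD(1)[OF F] by auto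
        obtain a where a: "c s = {x \<in> X. x \<one> = a}" using c s by (auto simp: U0_def)
        have "z s = a" if z: "z \<in> v" for z
        proof -
          have "z \<in> shift G s ` c s" using z c s by auto
          then obtain u where "u \<in> c s" "z = shift G s u" by blast
          then show ?thesis using sG a by (auto simp: shift_apply)
        qed
        then show ?thesis using \<open>x \<in> v\<close> \<open>y \<in> v\<close> by metis
      qed
      then show ?thesis by (auto simp: restrict_def)
    qed
    \<comment> \<open>All points of a member of the subcover have the same restriction to
      \<open>F\<close>, so any chosen point yields its pattern, and the members surject onto the
      patterns.\<close>
    have "patterns X F \<subseteq> (\<lambda>v. restrict (SOME x. x \<in> v) F) ` V"
    proof
      fix p assume "p \<in> patterns X F"
      then obtain x where x: "x \<in> X" "p = restrict x F" by (auto simp: patterns_def)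
      then obtain v where v: "v \<in> V" "x \<in> v" using V(4) by blast
      have "(SOME x. x \<in> v) \<in> v" by (rule someI[of "\<lambda>x. x \<in> v", OF v(2)])
      then have "p = restrict (SOME x. x \<in> v) F" using atom[OF v(1)] v(2) x(2) by blast
      then show "p \<in> (\<lambda>v. restrict (SOME x. x \<in> v) F) ` V" using v by blast
    qed
    then show ?thesis using surj_card_le[OF V(2)] V(3) by metis
  qed
  have "\<forall>\<^sub>F F in folner G. ereal (pattern_rate X)
      \<le> log_nat (min_subcover ?T (cover_join ?T (shift G) U0 F)) / ereal (real (card F))"
    using folner_fin_subsets
  proof eventually_elim
    fix F assume F: "F \<in> fin_subsets G"
    have "0 < card (patterns X F)"
      using finite_patterns[OF XA F] X(3) by (auto simp: card_gt_0_iff patterns_def)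
    then have "ereal (pattern_rate X) \<le> log_nat (card (patterns X F)) / ereal (real (card F))"
      using pattern_rate_le[OF F] fin_subsetsD(4)[OF F] by (simp add: log_nat_div)
    also have "\<dots> \<le> log_nat (min_subcover ?T (cover_join ?T (shift G) U0 F)) / ereal (real (card F))"
      using fin_subsetsD(4)[OF F] by (intro ereal_divide_right_mono log_nat_mono min_ge F) auto
    finally show "ereal (pattern_rate X)
      \<le> log_nat (min_subcover ?T (cover_join ?T (shift G) U0 F)) / ereal (real (card F))" .
  qed
  then have "ereal (pattern_rate X) \<le> Liminf (folner G)
      (\<lambda>F. log_nat (min_subcover ?T (cover_join ?T (shift G) U0 F)) / ereal (real (card F)))"
    by (rule Liminf_bounded)
  also have "\<dots> \<le> cover_entropy G ?T (shift G) U0"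
    unfolding cover_entropy_def by (rule Liminf_le_Limsup[OF folner_ne_bot])
  finally have lower: "ereal (pattern_rate X) \<le> cover_entropy G ?T (shift G) U0" .
  show ?thesis
    unfolding shift_entropy_def topological_entropy_def
    by (rule antisym[OF SUP_least[OF upper]], assumption, rule SUP_upper2, rule U0, rule lower)
qed

end

section \<open>Subshifts given by local rules\<close>

text \<open>\<open>P F\<close> is the rule attached to a finite set \<open>F\<close> and
  \<open>E F\<close> the coordinates it reads. Antitonicity lets finitely many rules be merged into
  one, translation yields invariance of \<open>X\<close>, and constant configurations keep
  \<open>X\<close> nonempty.\<close>

locale local_subshift = amenable_alphabet +
  fixes P :: "'a set \<Rightarrow> ('a \<Rightarrow> 'a) \<Rightarrow> bool" and E :: "'a set \<Rightarrow> 'a set" and X :: "('a \<Rightarrow> 'a) set"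
  assumes window: "F \<in> fin_subsets G \<Longrightarrow> E F \<in> fin_subsets G"
    and local: "F \<in> fin_subsets G \<Longrightarrow> \<forall>t\<in>E F. x t = y t \<Longrightarrow> P F x \<Longrightarrow> P F y"
    and anti_mono: "F' \<in> fin_subsets G \<Longrightarrow> F \<subseteq> F' \<Longrightarrow> x \<in> carrier G \<rightarrow>\<^sub>E A \<Longrightarrow> P F' x \<Longrightarrow> P F x"
    and translate: "F \<in> fin_subsets G \<Longrightarrow> g \<in> carrier G \<Longrightarrow> x \<in> carrier G \<rightarrow>\<^sub>E A \<Longrightarrow>
      P (g <# F) x \<Longrightarrow> P F (shift G (inv g) x)"
    and constant_config: "a \<in> A \<Longrightarrow> F \<in> fin_subsets G \<Longrightarrow> P F (\<lambda>t\<in>carrier G. a)"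
    and X_def: "X = {x \<in> carrier G \<rightarrow>\<^sub>E A. \<forall>F\<in>fin_subsets G. P F x}"
begin

lemma X_subset: "X \<subseteq> carrier G \<rightarrow>\<^sub>E A"
  by (auto simp: X_def)

lemma X_ne: "X \<noteq> {}"
proof -
  obtain a where a: "a \<in> A" using A_ne by blast
  then have "(\<lambda>t\<in>carrier G. a) \<in> X" unfolding X_def using constant_config[OF a] by auto
  then show ?thesis by blast
qed

lemma X_invariant: "shift_invariant G X"
  unfolding shift_invariant_def
proof (intro ballI)
  fix s x assume s: "s \<in> carrier G" and x: "x \<in> X"
  have xA: "x \<in> carrier G \<rightarrow>\<^sub>E A" using x X_subset by blast
  have "P F (shift G (inv (inv s)) x)" if F: "F \<in> fin_subsets G" for F
    using x fin_subsets_l_coset[OF inv_closed[OF s] F] unfolding X_def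
    by (intro translate[OF F inv_closed[OF s] xA]) blast
  then show "shift G s x \<in> X" using s shift_closed[OF s xA] by (simp add: X_def)
qed

lemma openin_violation:
  assumes "F \<in> fin_subsets G"
  shows "openin (full_shift_topology G A) {x \<in> carrier G \<rightarrow>\<^sub>E A. \<not> P F x}"
proof (rule openin_finite_coords[OF window[OF assms]])
  fix x y assume "\<forall>k\<in>E F. x k = y k" "\<not> P F x"
  then show "\<not> P F y" using local[OF assms, of y x] by auto
qed

lemma X_closed: "closedin (full_shift_topology G A) X"
proof -
  have "X = topspace (full_shift_topology G A) - (\<Union>F\<in>fin_subsets G. {x \<in> carrier G \<rightarrow>\<^sub>E A. \<not> P F x})"
    by (auto simp: X_def topspace_full_shift)
  then show ?thesis
    using openin_violation by (auto intro!: closedin_diff openin_Union)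
qed

text \<open>Compactness: the points modelled by \<open>X\<close> on \<open>F0\<close> form an open
  set containing \<open>X\<close>, and every other point violates some rule. Finitely many violation
  sets complete a cover, and \<open>F'\<close> is the union of their windows.\<close>

lemma finite_approximation:
  assumes F0: "F0 \<in> fin_subsets G"
  shows "\<exists>F'\<in>fin_subsets G. \<forall>x\<in>carrier G \<rightarrow>\<^sub>E A. P F' x \<longrightarrow> (\<exists>z\<in>X. \<forall>t\<in>F0. x t = z t)"
proof -
  define B where "B = {x \<in> carrier G \<rightarrow>\<^sub>E A. \<exists>z\<in>X. \<forall>t\<in>F0. x t = z t}"
  define N where "N F = {x \<in> carrier G \<rightarrow>\<^sub>E A. \<not> P F x}" for F
  have "openin (full_shift_topology G A) B"
    unfolding B_def by (rule openin_finite_coords[OF F0]) auto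
  then have "\<forall>V\<in>insert B (N ` fin_subsets G). openin (full_shift_topology G A) V"
    using openin_violation by (auto simp: N_def)
  moreover have "carrier G \<rightarrow>\<^sub>E A \<subseteq> \<Union> (insert B (N ` fin_subsets G))"
    by (auto simp: B_def N_def X_def)
  ultimately have "\<exists>\<F>. finite \<F> \<and> \<F> \<subseteq> insert B (N ` fin_subsets G) \<and> carrier G \<rightarrow>\<^sub>E A \<subseteq> \<Union>\<F>"
    using compact_full_shift[unfolded compact_space_alt topspace_full_shift, rule_format]
    by (metis (no_types, lifting))
  then obtain \<F> where \<F>: "finite \<F>" "\<F> \<subseteq> insert B (N ` fin_subsets G)" "carrier G \<rightarrow>\<^sub>E A \<subseteq> \<Union>\<F>"
    by blast
  have "finite (\<F> - {B})" "\<F> - {B} \<subseteq> N ` fin_subsets G" using \<F> by auto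
  then obtain \<G> where \<G>: "\<G> \<subseteq> fin_subsets G" "finite \<G>" "\<F> - {B} = N ` \<G>"
    by (meson finite_subset_image)
  define F' where "F' = insert \<one> (\<Union>\<G>)"
  have F': "F' \<in> fin_subsets G"
    using \<G> unfolding F'_def fin_subsets_def by auto
  have "\<exists>z\<in>X. \<forall>t\<in>F0. x t = z t" if x: "x \<in> carrier G \<rightarrow>\<^sub>E A" "P F' x" for x
  proof -
    have "x \<notin> N F" if "F \<in> \<G>" for F
    proof -
      have "F \<subseteq> F'" using that by (auto simp: F'_def)
      then show ?thesis using anti_mono[OF F' _ x] by (simp add: N_def)
    qed
    moreover obtain V where "V \<in> \<F>" "x \<in> V" using \<F>(3) x(1) by blast
    ultimately have "x \<in> B" using \<G>(3) by blast
    then show ?thesis by (simp add: B_def)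
  qed
  then show ?thesis using F' by blast
qed

text \<open>Rules are stated for configurations on the whole group, so the hypothesis
  \<open>deep\<close> speaks of all extensions of \<open>x\<close>. The rule on
  \<open>g <# F'\<close> is moved to \<open>F'\<close>, where \<open>finite_approximation\<close>
  supplies a point of \<open>X\<close> that is shifted back by \<open>g\<close>.\<close>

lemma locally_modelledI:
  assumes S: "\<And>F. F \<in> fin_subsets G \<Longrightarrow> S F \<subseteq> D F \<rightarrow>\<^sub>E A"
    and K: "K \<in> fin_subsets G" "\<And>F. F \<in> fin_subsets G \<Longrightarrow> D F \<subseteq> F <#> K"
    and deep: "\<And>F'. F' \<in> fin_subsets G \<Longrightarrow> \<exists>L\<in>fin_subsets G. \<forall>F\<in>fin_subsets G. \<forall>g\<in>carrier G.
      g <# L \<subseteq> F \<longrightarrow> (\<forall>x\<in>S F. \<forall>y\<in>carrier G \<rightarrow>\<^sub>E A. (\<forall>t\<in>D F. y t = x t) \<longrightarrow> P (g <# F') y)"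
  shows "locally_modelled X D S"
  unfolding locally_modelled_def
proof (intro conjI)
  show "\<forall>F\<in>fin_subsets G. S F \<subseteq> D F \<rightarrow>\<^sub>E A" using S by blast
  show "\<exists>K\<in>fin_subsets G. \<forall>F\<in>fin_subsets G. D F \<subseteq> F <#> K" using K by blast
  show "\<forall>F0\<in>fin_subsets G. \<exists>L\<in>fin_subsets G. \<forall>F\<in>fin_subsets G. \<forall>g\<in>carrier G. g <# L \<subseteq> F \<longrightarrow>
      (\<forall>x\<in>S F. \<exists>z\<in>X. \<forall>t\<in>(g <# F0) \<inter> D F. x t = z t)"
  proof
    fix F0 assume F0: "F0 \<in> fin_subsets G"
    obtain F' where F': "F' \<in> fin_subsets G"
      "\<forall>x\<in>carrier G \<rightarrow>\<^sub>E A. P F' x \<longrightarrow> (\<exists>z\<in>X. \<forall>t\<in>F0. x t = z t)"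
      using finite_approximation[OF F0] by (elim bexE)
    obtain L where L: "L \<in> fin_subsets G" "\<forall>F\<in>fin_subsets G. \<forall>g\<in>carrier G.
      g <# L \<subseteq> F \<longrightarrow> (\<forall>x\<in>S F. \<forall>y\<in>carrier G \<rightarrow>\<^sub>E A. (\<forall>t\<in>D F. y t = x t) \<longrightarrow> P (g <# F') y)"
      using deep[OF F'(1)] by (elim bexE)
    have deepX: "\<exists>z\<in>X. \<forall>t\<in>(g <# F0) \<inter> D F. x t = z t"
      if F: "F \<in> fin_subsets G" and g: "g \<in> carrier G" and gL: "g <# L \<subseteq> F" and x: "x \<in> S F" for F g x
    proof -
      obtain a where a: "a \<in> A" using A_ne by blast
      \<comment> \<open>Any letter may fill the places outside \<open>D F\<close>, since
        \<open>deep\<close> holds for every extension.\<close>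
      define y where "y = (\<lambda>t\<in>carrier G. if t \<in> D F then x t else a)"
      have DG: "D F \<subseteq> carrier G"
        using K(2)[OF F] fin_subsetsD(1)[OF fin_subsets_set_mult[OF F K(1)]] by blast
      have xD: "x t \<in> A" if "t \<in> D F" for t using S[OF F] x that by (auto simp: PiE_iff)
      have yA: "y \<in> carrier G \<rightarrow>\<^sub>E A" unfolding y_def using xD a by auto
      have yx: "y t = x t" if "t \<in> D F" for t using that DG by (auto simp: y_def)
      have "P (g <# F') y" using L(2) F g gL x yA yx by blast
      then have "P F' (shift G (inv g) y)" by (rule translate[OF F'(1) g yA])
      then obtain z where z: "z \<in> X" "\<forall>t\<in>F0. shift G (inv g) y t = z t"
        using F'(2) shift_closed[OF inv_closed[OF g] yA] by blast
      have "x t = shift G g z t" if t: "t \<in> (g <# F0) \<inter> D F" for t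
      proof -
        obtain f where f: "f \<in> F0" "t = g \<otimes> f" using t by (auto simp: l_coset_def)
        have fG: "f \<in> carrier G" using f fin_subsetsD(1)[OF F0] by auto
        have "shift G (inv g) y f = z f" using z(2) f(1) by blast
        then have "z f = y t" using f(2) g fG by (simp add: shift_apply)
        moreover have "shift G g z t = z f" using f g fG by (simp add: shift_apply m_assoc[symmetric])
        ultimately show ?thesis using yx t by simp
      qed
      moreover have "shift G g z \<in> X" using X_invariant z(1) g unfolding shift_invariant_def by blast
      ultimately show ?thesis by blast
    qed
    show "\<exists>L\<in>fin_subsets G. \<forall>F\<in>fin_subsets G. \<forall>g\<in>carrier G. g <# L \<subseteq> F \<longrightarrow>
      (\<forall>x\<in>S F. \<exists>z\<in>X. \<forall>t\<in>(g <# F0) \<inter> D F. x t = z t)"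
      by (rule bexI[OF _ L(1)], intro ballI impI, rule deepX)
  qed
qed

text \<open>Containing the restrictions of \<open>X\<close> forces every quotient, whether by
  \<open>card F\<close> or by \<open>card (D F)\<close>, to be at least the rate; local modelling
  gives the matching upper limit.\<close>

lemma shift_entropy_limit:
  assumes S: "locally_modelled X D S"
    and D: "\<And>F. F \<in> fin_subsets G \<Longrightarrow> D F \<in> fin_subsets G" "\<And>F. F \<in> fin_subsets G \<Longrightarrow> card F \<le> card (D F)"
    and sub: "\<And>F. F \<in> fin_subsets G \<Longrightarrow> patterns X (D F) \<subseteq> S F"
  shows "((\<lambda>F. log_nat (card (S F)) / ereal (real (card F))) \<longlongrightarrow> shift_entropy G A X) (folner G)" (is ?lim)
    and "shift_entropy G A X = (INF F \<in> fin_subsets G. log_nat (card (S F)) / ereal (real (card (D F))))" (is ?inf)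
proof -
  have ent: "shift_entropy G A X = ereal (pattern_rate X)"
    by (rule shift_entropy_eq_pattern_rate[OF X_closed X_invariant X_ne])
  have S_D: "S F \<subseteq> D F \<rightarrow>\<^sub>E A" if "F \<in> fin_subsets G" for F
    using S that unfolding locally_modelled_def by blast
  have le: "card (patterns X (D F)) \<le> card (S F)" if "F \<in> fin_subsets G" for F
    using finite_configs[OF D(1) S_D] sub that by (intro card_mono) auto
  have pos: "0 < card (S F)" if F: "F \<in> fin_subsets G" for F
  proof -
    have "0 < card (patterns X (D F))"
      using finite_patterns[OF X_subset D(1)[OF F]] X_ne by (auto simp: card_gt_0_iff patterns_def)
    then show ?thesis using le[OF F] by linarith
  qed
  show lim: ?lim
    unfolding ent
  proof (rule rate_tendsto[OF X_subset X_invariant X_ne S pos])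
    fix F assume F: "F \<in> fin_subsets G"
    show "pattern_rate X \<le> ln (card (S F)) / card F"
      by (rule pattern_rate_le_extension[OF F D(1)[OF F] D(2)[OF F] le[OF F] X_ne X_subset])
  qed
  show ?inf
  proof (rule antisym)
    show "shift_entropy G A X \<le> (INF F \<in> fin_subsets G. log_nat (card (S F)) / ereal (real (card (D F))))"
    proof (rule INF_greatest)
      fix F assume F: "F \<in> fin_subsets G"
      have "pattern_rate X \<le> ln (card (S F)) / card (D F)"
        by (rule pattern_rate_le_extension[OF D(1)[OF F] D(1)[OF F] order_refl le[OF F] X_ne X_subset])
      then show "shift_entropy G A X \<le> log_nat (card (S F)) / ereal (real (card (D F)))"
        using pos[OF F] fin_subsetsD(4)[OF D(1)[OF F]] by (simp add: ent log_nat_div)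
    qed
    show "(INF F \<in> fin_subsets G. log_nat (card (S F)) / ereal (real (card (D F)))) \<le> shift_entropy G A X"
    \<comment> \<open>Dividing by the larger \<open>card (D F)\<close> only lowers the quotient, so
      the infimum stays below the quotients that converge.\<close>
    proof (rule tendsto_lowerbound[OF lim _ folner_ne_bot], rule eventually_mono[OF folner_fin_subsets])
      fix F assume F: "F \<in> fin_subsets G"
      have "(INF F \<in> fin_subsets G. log_nat (card (S F)) / ereal (real (card (D F))))
        \<le> log_nat (card (S F)) / ereal (real (card (D F)))"
        using F by (rule INF_lower)
      also have "\<dots> \<le> log_nat (card (S F)) / ereal (real (card F))"
        using pos[OF F] fin_subsetsD(4)[OF F] D(2)[OF F] fin_subsetsD(4)[OF D(1)[OF F]]
        by (simp add: log_nat_div divide_left_mono)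
      finally show "(INF F \<in> fin_subsets G. log_nat (card (S F)) / ereal (real (card (D F))))
        \<le> log_nat (card (S F)) / ereal (real (card F))" .
    qed
  qed
qed

end

section \<open>Injective and bijective configurations\<close>

context amenable_alphabet begin

lemma l_cancelD:
  assumes "a \<otimes> b = a \<otimes> c" "a \<in> carrier G" "b \<in> carrier G" "c \<in> carrier G"
  shows "b = c"
  using assms Units_l_cancel[of a b c] by (simp only: Units_eq)

text \<open>Left translation commutes with right multiplication by letters, so
  \<open>mult_map G\<close> is equivariant.\<close>

lemma mult_map_shift:
  assumes "g \<in> carrier G" "s \<in> carrier G" "x \<in> carrier G \<rightarrow>\<^sub>E A"
  shows "mult_map G (shift G (inv g) x) s = inv g \<otimes> mult_map G x (g \<otimes> s)"
proof -
  have "x (g \<otimes> s) \<in> carrier G" using assms A_carrier by (auto simp: PiE_iff)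
  then show ?thesis using assms by (simp add: mult_map_def shift_apply m_assoc[symmetric])
qed

lemma mult_map_closed:
  assumes "s \<in> carrier G" "x s \<in> A"
  shows "mult_map G x s \<in> carrier G"
  using assms A_carrier by (auto simp: mult_map_def)

lemma mult_map_restrict: "s \<in> F \<Longrightarrow> mult_map G (restrict x F) s = mult_map G x s"
  by (simp add: mult_map_def)

lemma inj_on_mult_map_cong:
  assumes "\<forall>t\<in>F. x t = y t"
  shows "inj_on (mult_map G x) F \<longleftrightarrow> inj_on (mult_map G y) F"
  using assms by (intro inj_on_cong) (simp add: mult_map_def)

lemma inj_on_mult_map_shift:
  assumes F: "F \<subseteq> carrier G" and g: "g \<in> carrier G" and x: "x \<in> carrier G \<rightarrow>\<^sub>E A"
    and inj: "inj_on (mult_map G x) (g <# F)"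
  shows "inj_on (mult_map G (shift G (inv g) x)) F"
proof (rule inj_onI)
  fix s t assume s: "s \<in> F" and t: "t \<in> F"
    and eq: "mult_map G (shift G (inv g) x) s = mult_map G (shift G (inv g) x) t"
  have G: "s \<in> carrier G" "t \<in> carrier G" using s t F by auto
  have cl: "mult_map G x (g \<otimes> u) \<in> carrier G" if "u \<in> carrier G" for u
    using that m_closed[OF g that] x by (intro mult_map_closed) (simp_all add: PiE_iff)
  have "inv g \<otimes> mult_map G x (g \<otimes> s) = inv g \<otimes> mult_map G x (g \<otimes> t)"
    using eq G g x by (simp add: mult_map_shift)
  then have "mult_map G x (g \<otimes> s) = mult_map G x (g \<otimes> t)"
    by (rule l_cancelD[OF _ inv_closed[OF g] cl[OF G(1)] cl[OF G(2)]])
  then have "g \<otimes> s = g \<otimes> t"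
    by (rule inj_onD[OF inj]) (use s t in \<open>auto simp: l_coset_def\<close>)
  then show "s = t" by (rule l_cancelD[OF _ g G])
qed

text \<open>Locates preimages: whatever maps to \<open>h\<close> lies in
  \<open>h <# set_inv A\<close>. This makes surjectivity a local rule.\<close>

lemma mult_map_preimage:
  assumes "s \<in> carrier G" "x s \<in> A"
  shows "s = mult_map G x s \<otimes> inv (x s)"
  using assms A_carrier by (auto simp: mult_map_def m_assoc subset_iff)

lemma inj_on_mult_map_constant:
  assumes "a \<in> A" "F \<subseteq> carrier G"
  shows "inj_on (mult_map G (\<lambda>t\<in>carrier G. a)) F"
proof (rule inj_onI)
  fix s t assume st: "s \<in> F" "t \<in> F" "mult_map G (\<lambda>t\<in>carrier G. a) s = mult_map G (\<lambda>t\<in>carrier G. a) t"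
  then have "s \<in> carrier G" "t \<in> carrier G" "a \<in> carrier G" using assms A_carrier by auto
  then show "s = t" using st(3) by (simp add: mult_map_def)
qed

section \<open>Injectivity and bijectivity as local rules\<close>

lemma mem_set_mult_inv: "t \<in> F <#> set_inv A \<longleftrightarrow> (\<exists>f\<in>F. \<exists>a\<in>A. t = f \<otimes> inv a)"
  by (auto simp: set_mult_def SET_INV_def)

lemma l_coset_set_mult_inv:
  assumes "F \<subseteq> carrier G" "g \<in> carrier G"
  shows "(g <# F) <#> set_inv A = g <# (F <#> set_inv A)"
proof -
  have "set_inv A \<subseteq> carrier G" using A_carrier by (auto simp: SET_INV_def)
  then show ?thesis
    using assms by (simp add: l_coset_eq_set_mult set_mult_assoc)
qed

lemmas A_inv_fin_subsets = fin_subsets_set_inv[OF A_fin_subsets]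

text \<open>Injectivity is a condition on pairs, so finite sets detect it, and the image of
  \<open>s\<close> depends only on the letter at \<open>s\<close>, so the rule on \<open>F\<close>
  reads \<open>F\<close> alone.\<close>

lemma local_subshift_inj:
  "local_subshift G A (\<lambda>F x. inj_on (mult_map G x) F) (\<lambda>F. F) (X_inj G A)"
proof (intro local_subshift.intro local_subshift_axioms.intro amenable_alphabet_axioms)
  show "X_inj G A = {x \<in> carrier G \<rightarrow>\<^sub>E A. \<forall>F\<in>fin_subsets G. inj_on (mult_map G x) F}"
  proof (intro equalityI subsetI)
    fix x assume "x \<in> X_inj G A"
    then show "x \<in> {x \<in> carrier G \<rightarrow>\<^sub>E A. \<forall>F\<in>fin_subsets G. inj_on (mult_map G x) F}"
      using fin_subsetsD(1) by (auto simp: X_inj_def intro: inj_on_subset)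
  next
    fix x assume x: "x \<in> {x \<in> carrier G \<rightarrow>\<^sub>E A. \<forall>F\<in>fin_subsets G. inj_on (mult_map G x) F}"
    have "inj_on (mult_map G x) (carrier G)"
    proof (rule inj_onI)
      fix s t assume st: "s \<in> carrier G" "t \<in> carrier G" "mult_map G x s = mult_map G x t"
      then have "{s, t} \<in> fin_subsets G" by (simp add: fin_subsets_def)
      then have "inj_on (mult_map G x) {s, t}" using x by blast
      then show "s = t" using st(3) by (rule inj_onD) auto
    qed
    then show "x \<in> X_inj G A" using x by (simp add: X_inj_def)
  qed
next
  fix F and g and x :: "'a \<Rightarrow> 'a"
  assume "F \<in> fin_subsets G" "g \<in> carrier G" "x \<in> carrier G \<rightarrow>\<^sub>E A" "inj_on (mult_map G x) (g <# F)"
  then show "inj_on (mult_map G (shift G (inv g) x)) F"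
    using inj_on_mult_map_shift fin_subsetsD(1) by blast
next
  fix F and x y :: "'a \<Rightarrow> 'a"
  assume "\<forall>t\<in>F. x t = y t" "inj_on (mult_map G x) F"
  then show "inj_on (mult_map G y) F" by (rule inj_on_mult_map_cong[THEN iffD1])
next
  fix F F' and x :: "'a \<Rightarrow> 'a"
  assume "F \<subseteq> F'" "inj_on (mult_map G x) F'"
  then show "inj_on (mult_map G x) F" by (rule inj_on_subset[rotated])
next
  fix a F assume "a \<in> A" "F \<in> fin_subsets G"
  then show "inj_on (mult_map G (\<lambda>t\<in>carrier G. a)) F"
    using inj_on_mult_map_constant fin_subsetsD(1) by blast
qed

text \<open>All possible preimages of \<open>F\<close> lie in \<open>F <#> set_inv A\<close>, so
  hitting \<open>F\<close> from there is the same as hitting it at all.\<close>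

definition onto_window :: "'a set \<Rightarrow> ('a \<Rightarrow> 'a) \<Rightarrow> bool" where
  "onto_window F x \<longleftrightarrow>
    inj_on (mult_map G x) (F <#> set_inv A) \<and> F \<subseteq> mult_map G x ` (F <#> set_inv A)"

text \<open>\<open>F\<close> may be hit from anywhere in a larger \<open>D\<close>: the preimages
  are automatically in \<open>F <#> set_inv A\<close>.\<close>

lemma onto_windowI:
  assumes x: "x \<in> D \<rightarrow> A" and D: "D \<subseteq> carrier G"
    and inj: "inj_on (mult_map G x) D" and onto: "F \<subseteq> mult_map G x ` D"
    and sub: "F <#> set_inv A \<subseteq> D" and xy: "\<forall>t\<in>D. y t = x t"
  shows "onto_window F y"
  unfolding onto_window_def
proof
  have "x t = y t" if "t \<in> F <#> set_inv A" for t
    using bspec[OF xy subsetD[OF sub that]] by simp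
  then show "inj_on (mult_map G y) (F <#> set_inv A)"
    using inj_on_subset[OF inj sub] inj_on_mult_map_cong[of "F <#> set_inv A" x y] by blast
  show "F \<subseteq> mult_map G y ` (F <#> set_inv A)"
  proof
    fix f assume f: "f \<in> F"
    then obtain s where s: "s \<in> D" "f = mult_map G x s" using onto by blast
    have xs: "x s \<in> A" using x s by blast
    have "s = f \<otimes> inv (x s)" unfolding s(2) using s D xs by (intro mult_map_preimage) auto
    then have "s \<in> F <#> set_inv A" using f xs unfolding mem_set_mult_inv by blast
    moreover have "mult_map G y s = f" using s xy by (simp add: mult_map_def)
    ultimately show "f \<in> mult_map G y ` (F <#> set_inv A)" by blast
  qed
qed

lemma X_bij_eq: "X_bij G A = {x \<in> carrier G \<rightarrow>\<^sub>E A. \<forall>F\<in>fin_subsets G. onto_window F x}"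
proof (intro equalityI subsetI)
  fix x assume x: "x \<in> X_bij G A"
  then have bij: "bij_betw (mult_map G x) (carrier G) (carrier G)" and xA: "x \<in> carrier G \<rightarrow>\<^sub>E A"
    by (auto simp: X_bij_def)
  have "onto_window F x" if F: "F \<in> fin_subsets G" for F
    using bij xA fin_subsetsD(1)[OF F] fin_subsetsD(1)[OF fin_subsets_set_mult[OF F A_inv_fin_subsets]]
    by (intro onto_windowI[of x "carrier G"]) (auto simp: bij_betw_def)
  then show "x \<in> {x \<in> carrier G \<rightarrow>\<^sub>E A. \<forall>F\<in>fin_subsets G. onto_window F x}" using xA by blast
next
  fix x assume x: "x \<in> {x \<in> carrier G \<rightarrow>\<^sub>E A. \<forall>F\<in>fin_subsets G. onto_window F x}"
  then have xA: "x \<in> carrier G \<rightarrow>\<^sub>E A" by blast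
  have "inj_on (mult_map G x) (carrier G)"
  proof (rule inj_onI)
    fix s t assume st: "s \<in> carrier G" "t \<in> carrier G" "mult_map G x s = mult_map G x t"
    obtain a where a: "a \<in> A" using A_ne by blast
    then have aG: "a \<in> carrier G" using A_carrier by blast
    \<comment> \<open>Multiplying by a letter \<open>a\<close> places \<open>s\<close> and
      \<open>t\<close> inside \<open>?F <#> set_inv A\<close>, where the rule grants
      injectivity.\<close>
    let ?F = "{s \<otimes> a, t \<otimes> a}"
    have "?F \<in> fin_subsets G" using st aG by (auto simp: fin_subsets_def)
    then have "inj_on (mult_map G x) (?F <#> set_inv A)" using x by (auto simp: onto_window_def)
    moreover have "s = (s \<otimes> a) \<otimes> inv a" "t = (t \<otimes> a) \<otimes> inv a" using st aG by (auto simp: m_assoc)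
    then have "s \<in> ?F <#> set_inv A" "t \<in> ?F <#> set_inv A"
      using a unfolding mem_set_mult_inv by blast+
    ultimately show "s = t" using st(3) by (meson inj_onD)
  qed
  moreover have "mult_map G x ` carrier G \<subseteq> carrier G"
    using xA by (auto intro!: mult_map_closed)
  moreover have "f \<in> mult_map G x ` carrier G" if f: "f \<in> carrier G" for f
  proof -
    note ff = fin_subsets_singleton[OF f]
    have "{f} \<subseteq> mult_map G x ` ({f} <#> set_inv A)" using x ff by (auto simp: onto_window_def)
    then show ?thesis using fin_subsetsD(1)[OF fin_subsets_set_mult[OF ff A_inv_fin_subsets]] by blast
  qed
  ultimately show "x \<in> X_bij G A" using xA by (auto simp: X_bij_def bij_betw_def)
qed

lemma local_subshift_bij:
  "local_subshift G A onto_window (\<lambda>F. F <#> set_inv A) (X_bij G A)"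
proof (intro local_subshift.intro local_subshift_axioms.intro amenable_alphabet_axioms)
  show "X_bij G A = {x \<in> carrier G \<rightarrow>\<^sub>E A. \<forall>F\<in>fin_subsets G. onto_window F x}" by (rule X_bij_eq)
next
  fix F assume "F \<in> fin_subsets G"
  then show "F <#> set_inv A \<in> fin_subsets G" by (rule fin_subsets_set_mult[OF _ A_inv_fin_subsets])
next
  fix F and x y :: "'a \<Rightarrow> 'a"
  assume "\<forall>t\<in>F <#> set_inv A. x t = y t" "onto_window F x"
  then show "onto_window F y"
    unfolding onto_window_def using inj_on_mult_map_cong[of "F <#> set_inv A" x y]
    by (auto simp: mult_map_def image_iff)
next
  fix F F' and x :: "'a \<Rightarrow> 'a"
  assume F': "F' \<in> fin_subsets G" and sub: "F \<subseteq> F'" and x: "x \<in> carrier G \<rightarrow>\<^sub>E A" "onto_window F' x"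
  note FA = fin_subsetsD(1)[OF fin_subsets_set_mult[OF F' A_inv_fin_subsets]]
  show "onto_window F x"
  proof (rule onto_windowI[OF _ FA])
    show "x \<in> (F' <#> set_inv A) \<rightarrow> A" using FA x(1) by (auto simp: PiE_iff)
    show "inj_on (mult_map G x) (F' <#> set_inv A)" "F \<subseteq> mult_map G x ` (F' <#> set_inv A)"
      using x(2) sub by (auto simp: onto_window_def)
    show "F <#> set_inv A \<subseteq> F' <#> set_inv A" by (rule mono_set_mult[OF sub subset_refl])
  qed simp
next
  fix F g and x :: "'a \<Rightarrow> 'a"
  assume F: "F \<in> fin_subsets G" and g: "g \<in> carrier G" and x: "x \<in> carrier G \<rightarrow>\<^sub>E A"
    and P: "onto_window (g <# F) x"
  note FG = fin_subsetsD(1)[OF F] and FA = fin_subsetsD(1)[OF fin_subsets_set_mult[OF F A_inv_fin_subsets]]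
  have eq: "(g <# F) <#> set_inv A = g <# (F <#> set_inv A)" by (rule l_coset_set_mult_inv[OF FG g])
  show "onto_window F (shift G (inv g) x)"
    unfolding onto_window_def
  proof
    show "inj_on (mult_map G (shift G (inv g) x)) (F <#> set_inv A)"
      using P unfolding onto_window_def eq by (intro inj_on_mult_map_shift[OF FA g x]) blast
    show "F \<subseteq> mult_map G (shift G (inv g) x) ` (F <#> set_inv A)"
    proof
      fix f assume f: "f \<in> F"
      then have "g \<otimes> f \<in> g <# F" by (auto simp: l_coset_def)
      then have "g \<otimes> f \<in> mult_map G x ` (g <# (F <#> set_inv A))"
        using P unfolding onto_window_def eq by blast
      then obtain u where u: "u \<in> F <#> set_inv A" "g \<otimes> f = mult_map G x (g \<otimes> u)"
        by (auto simp: l_coset_def)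
      have "u \<in> carrier G" using u FA by blast
      then have "mult_map G (shift G (inv g) x) u = inv g \<otimes> (g \<otimes> f)"
        using g x u by (simp add: mult_map_shift)
      also have "\<dots> = f" using g f FG by (auto simp: m_assoc[symmetric])
      finally show "f \<in> mult_map G (shift G (inv g) x) ` (F <#> set_inv A)" using u(1) by blast
    qed
  qed
next
  fix a F assume a: "a \<in> A" and F: "F \<in> fin_subsets G"
  have aG: "a \<in> carrier G" using a A_carrier by blast
  show "onto_window F (\<lambda>t\<in>carrier G. a)"
  proof (rule onto_windowI[of _ "carrier G"])
    show "F \<subseteq> mult_map G (\<lambda>t\<in>carrier G. a) ` carrier G"
    proof
      fix f assume "f \<in> F"
      then have fG: "f \<in> carrier G" using fin_subsetsD(1)[OF F] by blast
      then have "mult_map G (\<lambda>t\<in>carrier G. a) (f \<otimes> inv a) = f"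
        using aG by (simp add: mult_map_def m_assoc)
      then show "f \<in> mult_map G (\<lambda>t\<in>carrier G. a) ` carrier G" using fG aG
        by (intro image_eqI[of _ _ "f \<otimes> inv a"]) simp_all

    qed
    show "F <#> set_inv A \<subseteq> carrier G"
      by (rule fin_subsetsD(1)[OF fin_subsets_set_mult[OF F A_inv_fin_subsets]])
    show "inj_on (mult_map G (\<lambda>t\<in>carrier G. a)) (carrier G)"
      by (rule inj_on_mult_map_constant[OF a subset_refl])
  qed (use a in simp_all)
qed

section \<open>Finite configurations as local models\<close>

lemma subset_set_mult_one:
  assumes "F \<subseteq> carrier G"
  shows "F \<subseteq> F <#> {\<one>}"
proof
  fix s assume s: "s \<in> F"
  then have "s \<otimes> \<one> \<in> F <#> {\<one>}" unfolding set_mult_def by blast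
  then show "s \<in> F <#> {\<one>}" using s assms by (simp add: subset_iff)
qed

text \<open>Injectivity passes to subsets, so a translate of \<open>F'\<close> inside
  \<open>F\<close> is already deep enough.\<close>

lemma locally_modelled_inj_on: "locally_modelled (X_inj G A) (\<lambda>F. F) (X_inj_on G A)"
proof (rule local_subshift.locally_modelledI[OF local_subshift_inj, of _ _ "{\<one>}"])
  show "{\<one>} \<in> fin_subsets G" by (simp add: fin_subsets_singleton)
  show "F \<subseteq> F <#> {\<one>}" if "F \<in> fin_subsets G" for F using that by (intro subset_set_mult_one fin_subsetsD)
  show "X_inj_on G A F \<subseteq> F \<rightarrow>\<^sub>E A" for F by (auto simp: X_inj_on_def)
  fix F' assume F': "F' \<in> fin_subsets G"
  have deep: "inj_on (mult_map G y) (g <# F')"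
    if "g <# F' \<subseteq> F" "x \<in> X_inj_on G A F" "\<forall>t\<in>F. y t = x t" for F g x y
  proof -
    have "inj_on (mult_map G y) F"
      using inj_on_mult_map_cong[OF that(3)] that(2) by (simp add: X_inj_on_def)
    then show ?thesis using that(1) by (rule inj_on_subset)
  qed
  show "\<exists>L\<in>fin_subsets G. \<forall>F\<in>fin_subsets G. \<forall>g\<in>carrier G. g <# L \<subseteq> F \<longrightarrow>
      (\<forall>x\<in>X_inj_on G A F. \<forall>y\<in>carrier G \<rightarrow>\<^sub>E A. (\<forall>t\<in>F. y t = x t) \<longrightarrow> inj_on (mult_map G y) (g <# F'))"
    by (rule bexI[OF _ F'], intro ballI impI, rule deep)
qed

text \<open>Every point of \<open>F\<close> is hit, so again depth \<open>F'\<close> suffices; the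
  enlargement by \<open>set_inv A\<close> is built into the domain.\<close>

lemma locally_modelled_onto:
  "locally_modelled (X_bij G A) (\<lambda>F. F <#> set_inv A) (\<lambda>F. X_onto G A (F <#> set_inv A) F)"
proof (rule local_subshift.locally_modelledI[OF local_subshift_bij _ A_inv_fin_subsets])
  show "X_onto G A (F <#> set_inv A) F \<subseteq> (F <#> set_inv A) \<rightarrow>\<^sub>E A" for F
    by (auto simp: X_onto_def X_inj_on_def)
  show "F <#> set_inv A \<subseteq> F <#> set_inv A" for F by simp
  fix F' assume F': "F' \<in> fin_subsets G"
  have deep: "onto_window (g <# F') y"
    if F: "F \<in> fin_subsets G" and sub: "g <# F' \<subseteq> F" and x: "x \<in> X_onto G A (F <#> set_inv A) F"
      and xy: "\<forall>t\<in>F <#> set_inv A. y t = x t" for F g x y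
  proof (rule onto_windowI[OF _ fin_subsetsD(1)[OF fin_subsets_set_mult[OF F A_inv_fin_subsets]]])
    show "x \<in> (F <#> set_inv A) \<rightarrow> A" "inj_on (mult_map G x) (F <#> set_inv A)"
      "g <# F' \<subseteq> mult_map G x ` (F <#> set_inv A)"
      using x sub by (auto simp: X_onto_def X_inj_on_def)
    show "(g <# F') <#> set_inv A \<subseteq> F <#> set_inv A" by (rule mono_set_mult[OF sub subset_refl])
  qed (rule xy)
  show "\<exists>L\<in>fin_subsets G. \<forall>F\<in>fin_subsets G. \<forall>g\<in>carrier G. g <# L \<subseteq> F \<longrightarrow>
      (\<forall>x\<in>X_onto G A (F <#> set_inv A) F. \<forall>y\<in>carrier G \<rightarrow>\<^sub>E A.
        (\<forall>t\<in>F <#> set_inv A. y t = x t) \<longrightarrow> onto_window (g <# F') y)"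
    by (rule bexI[OF _ F'], intro ballI impI, rule deep)
qed

text \<open>Surjectivity is imposed only on those \<open>h\<close> with
  \<open>h <# set_inv A\<close> inside \<open>F\<close>, so the depth has to grow from
  \<open>F'\<close> to \<open>F' <#> set_inv A\<close>.\<close>

lemma locally_modelled_bij_on: "locally_modelled (X_bij G A) (\<lambda>F. F) (X_bij_on G A)"
proof (rule local_subshift.locally_modelledI[OF local_subshift_bij, of _ _ "{\<one>}"])
  show "{\<one>} \<in> fin_subsets G" by (simp add: fin_subsets_singleton)
  show "F \<subseteq> F <#> {\<one>}" if "F \<in> fin_subsets G" for F using that by (intro subset_set_mult_one fin_subsetsD)
  show "X_bij_on G A F \<subseteq> F \<rightarrow>\<^sub>E A" for F by (auto simp: X_bij_on_def X_inj_on_def)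
  fix F' assume F': "F' \<in> fin_subsets G"
  have deep: "onto_window (g <# F') y"
    if F: "F \<in> fin_subsets G" and g: "g \<in> carrier G" and sub: "g <# (F' <#> set_inv A) \<subseteq> F"
      and x: "x \<in> X_bij_on G A F" and xy: "\<forall>t\<in>F. y t = x t" for F g x y
  proof (rule onto_windowI[OF _ fin_subsetsD(1)[OF F]])
    show "x \<in> F \<rightarrow> A" "inj_on (mult_map G x) F" using x by (auto simp: X_bij_on_def X_inj_on_def)
    show inF: "(g <# F') <#> set_inv A \<subseteq> F"
      using sub l_coset_set_mult_inv[OF fin_subsetsD(1)[OF F'] g] by simp
    show "g <# F' \<subseteq> mult_map G x ` F"
    proof
      fix h assume h: "h \<in> g <# F'"
      have "h <# set_inv A \<subseteq> (g <# F') <#> set_inv A" using h by (auto simp: l_coset_def set_mult_def)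
      then have "h <# set_inv A \<subseteq> F" using inF by blast
      moreover have "h \<in> carrier G" using h fin_subsetsD(1)[OF fin_subsets_l_coset[OF g F']] by blast
      ultimately show "h \<in> mult_map G x ` F" using x unfolding X_bij_on_def by blast
    qed
  qed (rule xy)
  show "\<exists>L\<in>fin_subsets G. \<forall>F\<in>fin_subsets G. \<forall>g\<in>carrier G. g <# L \<subseteq> F \<longrightarrow>
      (\<forall>x\<in>X_bij_on G A F. \<forall>y\<in>carrier G \<rightarrow>\<^sub>E A. (\<forall>t\<in>F. y t = x t) \<longrightarrow> onto_window (g <# F') y)"
    by (rule bexI[OF _ fin_subsets_set_mult[OF F' A_inv_fin_subsets]], intro ballI impI, rule deep)
qed

lemma patterns_X_inj: "F \<subseteq> carrier G \<Longrightarrow> patterns (X_inj G A) F \<subseteq> X_inj_on G A F"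
  unfolding patterns_def
proof (rule image_subsetI)
  fix x assume F: "F \<subseteq> carrier G" and "x \<in> X_inj G A"
  then show "restrict x F \<in> X_inj_on G A F"
    using inj_on_mult_map_cong[of F x "restrict x F"] inj_on_subset[of "mult_map G x" "carrier G" F]
    by (auto simp: X_inj_def X_inj_on_def)
qed

text \<open>The preimage of \<open>h\<close> under the full map lies in
  \<open>h <# set_inv A\<close>, hence survives restriction to \<open>F\<close>. A free target
  \<open>H\<close> covers both cases: \<open>F\<close> itself for the domain
  \<open>F <#> set_inv A\<close>, and the points whose window lies in \<open>F\<close> for the
  domain \<open>F\<close>.\<close>

lemma patterns_X_bij:
  assumes F: "F \<subseteq> carrier G" and H: "H \<subseteq> carrier G" and sub: "\<And>h a. h \<in> H \<Longrightarrow> a \<in> A \<Longrightarrow> h \<otimes> inv a \<in> F"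
  shows "patterns (X_bij G A) F \<subseteq> X_onto G A F H"
  unfolding patterns_def
proof (rule image_subsetI)
  fix x assume x: "x \<in> X_bij G A"
  then have bij: "bij_betw (mult_map G x) (carrier G) (carrier G)" and xA: "x \<in> carrier G \<rightarrow>\<^sub>E A"
    by (auto simp: X_bij_def)
  have "x \<in> X_inj G A" using x by (auto simp: X_bij_def X_inj_def bij_betw_def)
  then have "restrict x F \<in> X_inj_on G A F" using patterns_X_inj[OF F] by (auto simp: patterns_def)
  moreover have "h \<in> mult_map G (restrict x F) ` F" if h: "h \<in> H" for h
  proof -
    obtain s where s: "s \<in> carrier G" "h = mult_map G x s"
      using bij h H unfolding bij_betw_def by blast
    have xs: "x s \<in> A" using xA s by blast
    have "s = h \<otimes> inv (x s)" unfolding s(2) by (rule mult_map_preimage[of s x, OF s(1) xs])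
    then have "s \<in> F" using sub[OF h xs] by simp
    then show ?thesis using s(2) by (auto simp: mult_map_restrict intro!: image_eqI[of _ _ s])
  qed
  ultimately show "restrict x F \<in> X_onto G A F H" by (auto simp: X_onto_def)
qed

lemma X_bij_on_eq: "X_bij_on G A F = X_onto G A F {s \<in> carrier G. s <# set_inv A \<subseteq> F}"
  by (simp add: X_bij_on_def X_onto_def)

end

theorem proposition3p6:
  fixes G :: "('g, 'm) monoid_scheme" (structure) and A :: "'g set"
  assumes "group G" and "countable (carrier G)" and "amenable G"
    and "finite A" and "A \<noteq> {}" and "A \<subseteq> carrier G"
  shows
    "shift_entropy G A (X_bij G A) =
       (INF F \<in> fin_subsets G.
          log_nat (card (X_onto G A (F <#> set_inv A) F)) / ereal (real (card (F <#> set_inv A))))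
     \<and> ((\<lambda>F. log_nat (card (X_onto G A (F <#> set_inv A) F)) / ereal (real (card F)))
          \<longlongrightarrow> shift_entropy G A (X_bij G A)) (folner G)
     \<and> ((\<lambda>F. log_nat (card (X_bij_on G A F)) / ereal (real (card F)))
          \<longlongrightarrow> shift_entropy G A (X_bij G A)) (folner G)
     \<and> shift_entropy G A (X_inj G A) =
       (INF F \<in> fin_subsets G. log_nat (card (X_inj_on G A F)) / ereal (real (card F)))
     \<and> ((\<lambda>F. log_nat (card (X_inj_on G A F)) / ereal (real (card F)))
          \<longlongrightarrow> shift_entropy G A (X_inj G A)) (folner G)"
proof -
  interpret amenable_alphabet G A
    using assms by (simp add: amenable_alphabet_def amenable_alphabet_axioms_def)
  note A_inv = A_inv_fin_subsets
  have sub_inj: "patterns (X_inj G A) F \<subseteq> X_inj_on G A F" if "F \<in> fin_subsets G" for F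
    using patterns_X_inj fin_subsetsD(1)[OF that] .
  have sub_onto: "patterns (X_bij G A) (F <#> set_inv A) \<subseteq> X_onto G A (F <#> set_inv A) F"
    if F: "F \<in> fin_subsets G" for F
  proof (rule patterns_X_bij)
    show "h \<otimes> inv a \<in> F <#> set_inv A" if "h \<in> F" "a \<in> A" for h a
      using that mem_set_mult_inv by blast
  qed (rule fin_subsetsD(1)[OF fin_subsets_set_mult[OF F A_inv]], rule fin_subsetsD(1)[OF F])
  have sub_bij: "patterns (X_bij G A) F \<subseteq> X_bij_on G A F" if F: "F \<in> fin_subsets G" for F
    unfolding X_bij_on_eq
    by (rule patterns_X_bij[OF fin_subsetsD(1)[OF F]]) (auto simp: l_coset_def SET_INV_def)
  show ?thesis
    \<comment> \<open>The configurations onto \<open>F\<close> use the domain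
      \<open>F <#> set_inv A\<close>; the other two families use \<open>F\<close> itself, where the
      conditions on the domain are closed by \<open>assumption\<close> and
      \<open>order_refl\<close>.\<close>
    by (rule conjI
      local_subshift.shift_entropy_limit(2)[OF local_subshift_bij locally_modelled_onto
        fin_subsets_set_mult[OF _ A_inv] le_card_set_mult[OF _ A_inv] sub_onto]
      local_subshift.shift_entropy_limit(1)[OF local_subshift_bij locally_modelled_onto
        fin_subsets_set_mult[OF _ A_inv] le_card_set_mult[OF _ A_inv] sub_onto]
      local_subshift.shift_entropy_limit(1)[OF local_subshift_bij locally_modelled_bij_on _ _ sub_bij]
      local_subshift.shift_entropy_limit(2)[OF local_subshift_inj locally_modelled_inj_on _ _ sub_inj]
      local_subshift.shift_entropy_limit(1)[OF local_subshift_inj locally_modelled_inj_on _ _ sub_inj]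
      order_refl | assumption)+
qed

end
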